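(* Let $N$ be a torsion-free finitely generated nilpotent group with a finite generating subset $S$, and let $i>0$. Then there exist a natural number $k$ and a constant $C>0$ such that $\|N_i^\varphi\|_S\le C(\|\varphi\|_S)^k$ for every $\varphi\in\mathrm{Aut}(N)$.
   Context: $\|g\|_S$ is word length; for $\varphi\in\mathrm{Aut}(N)$, $\|\varphi\|_S=\max_{s\in S}\|\varphi(s)\|_S$. For a finitely generated subgroup $H\le N$, $\|H\|_S=\min\{\max_{h\in X}\|h\|_S : X \text{ a finite generating subset of } H\}$. Lower central series: $\gamma_1(N)=N$, $\gamma_i(N)=[N,\gamma_{i-1}(N)]$. The $i$-th twisted centralizer is the subgroup $N_i^\varphi=\{x\in N: x\,\varphi(x)^{-1}\in\gamma_i(N)\}$. *)

theory Defs
  imports "HOL-Algebra.Algebra"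
begin

(* Lower central series, indexed from 1: gamma 1 = N, gamma (i+1) = [N, gamma i].
   gamma 0 is set to N as a harmless convention (never used, since i > 0). *)
fun lower_central :: "('a, 'b) monoid_scheme \<Rightarrow> nat \<Rightarrow> 'a set" where
  "lower_central G 0 = carrier G"
| "lower_central G (Suc 0) = carrier G"
| "lower_central G (Suc (Suc n)) =
     generate G {x \<otimes>\<^bsub>G\<^esub> y \<otimes>\<^bsub>G\<^esub> inv\<^bsub>G\<^esub> x \<otimes>\<^bsub>G\<^esub> inv\<^bsub>G\<^esub> y | x y.
                   x \<in> carrier G \<and> y \<in> lower_central G (Suc n)}"

definition nilpotent_group :: "('a, 'b) monoid_scheme \<Rightarrow> bool" where
  "nilpotent_group G \<longleftrightarrow> group G \<and> (\<exists>c. lower_central G c = {\<one>\<^bsub>G\<^esub>})"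

definition torsion_free :: "('a, 'b) monoid_scheme \<Rightarrow> bool" where
  "torsion_free G \<longleftrightarrow> (\<forall>x \<in> carrier G. \<forall>n::nat. n > 0 \<and> x [^]\<^bsub>G\<^esub> n = \<one>\<^bsub>G\<^esub> \<longrightarrow> x = \<one>\<^bsub>G\<^esub>)"

fun word_eval :: "('a, 'b) monoid_scheme \<Rightarrow> (bool \<times> 'a) list \<Rightarrow> 'a" where
  "word_eval G [] = \<one>\<^bsub>G\<^esub>"
| "word_eval G ((e, s) # w) =
     (if e then s else inv\<^bsub>G\<^esub> s) \<otimes>\<^bsub>G\<^esub> word_eval G w"

definition word_length :: "('a, 'b) monoid_scheme \<Rightarrow> 'a set \<Rightarrow> 'a \<Rightarrow> nat" where
  "word_length G S g = (LEAST n. \<exists>w. length w = n \<and> snd ` set w \<subseteq> S \<and> word_eval G w = g)"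

definition aut_norm :: "('a, 'b) monoid_scheme \<Rightarrow> 'a set \<Rightarrow> ('a \<Rightarrow> 'a) \<Rightarrow> nat" where
  "aut_norm G S \<phi> = Max (insert 0 ((\<lambda>s. word_length G S (\<phi> s)) ` S))"

definition subgroup_norm :: "('a, 'b) monoid_scheme \<Rightarrow> 'a set \<Rightarrow> 'a set \<Rightarrow> nat" where
  "subgroup_norm G S H = (LEAST m. \<exists>T. finite T \<and> T \<subseteq> H \<and> generate G T = H \<and>
       m = Max (insert 0 ((\<lambda>h. word_length G S h) ` T)))"

definition twisted_centralizer :: "('a, 'b) monoid_scheme \<Rightarrow> nat \<Rightarrow> ('a \<Rightarrow> 'a) \<Rightarrow> 'a set" where
  "twisted_centralizer G i \<phi> =
     {x \<in> carrier G. x \<otimes>\<^bsub>G\<^esub> inv\<^bsub>G\<^esub> (\<phi> x) \<in> lower_central G i}"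

end

(* Refine the lower central series to a central series with cyclic factors,
   N = M_1 >= M_2 >= ..., with M_j = <x_j, x_(j+1), ...> and [N, M_j] <= M_(j+1),
   passing through gamma_i. Such M_j are polynomially distorted in N: conjugating a
   generator by x_j^a lengthens it only polynomially in a, so the x_j can be collected.
   Put H_j = {x. x phi(x)^-1 in M_j}. Although M_j need not be phi-invariant, centrality
   makes x |-> x phi(x)^-1 M_(j+1) a homomorphism from H_j to the cyclic group M_j/M_(j+1),
   with kernel H_(j+1). Given generators h of H_j with values x_j^(a_h), distortion bounds the
   exponents a_h, and Bezout gives a short g with value d = gcd of the a_h and of the order of
   x_j mod M_(j+1). The kernel is generated, up to conjugation by g, by the elements
   h g^(-a_h/d), and by nilpotency boundedly many iterated commutators with g and its inverse
   account for that conjugation. Thus number and length of generators stay under control in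
   the finitely many steps from H_1 = N to N_i^phi. *)
theory Submission
  imports Defs
begin

text \<open>Each Bezout step may multiply lengths by a factor \<open>2 * B\<close>, so the degree of
  the final polynomial depends on the number of generators involved. That number must therefore be
  bounded independently of phi at every stage, together with the lengths. The kernel of a map onto a
  cyclic group is in general generated only by infinitely many conjugates under powers of g;
  nilpotency replaces them by a finite set whose size depends only on the class. One stage turns m
  generators into at most 3^c (m + 1): the added 1 records the order of x_j modulo M_(j+1), and each
  of the c commutator rounds keeps an element and adds two commutators. That order must be recorded
  because the factors of the lower central series may have torsion even in a torsion-free group.
  Polynomial distortion is the other delicate point: iterating the substitution y -> x y x^-1 letter
  by letter suggests an exponential bound. Since x y x^-1 = y z with z deeper in the series, the
  contributions of successive conjugations add up instead of multiplying.\<close>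

section \<open>Polynomially bounded functions and bounded Bezout coefficients\<close>

text \<open>The base \<open>n + 1\<close> is at least 1, so raising the exponent only weakens a
  bound; two bounds can thus be brought to a common exponent, with n = 0 included.\<close>

definition poly_bounded :: "(nat \<Rightarrow> nat) \<Rightarrow> bool" where
  "poly_bounded f \<longleftrightarrow> (\<exists>C k. \<forall>n. f n \<le> C * (n + 1) ^ k)"

lemma poly_bounded_const: "poly_bounded (\<lambda>_. c)"
  unfolding poly_bounded_def by (intro exI[of _ c] exI[of _ 0]) simp

lemma poly_bounded_id: "poly_bounded (\<lambda>n. n)"
  unfolding poly_bounded_def by (intro exI[of _ 1] exI[of _ 1]) simp

lemma poly_bounded_add:
  assumes "poly_bounded f" "poly_bounded g"
  shows "poly_bounded (\<lambda>n. f n + g n)"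
proof -
  obtain C k D l where f: "\<And>n. f n \<le> C * (n + 1) ^ k" and g: "\<And>n. g n \<le> D * (n + 1) ^ l"
    using assms unfolding poly_bounded_def by metis
  have "f n + g n \<le> (C + D) * (n + 1) ^ (k + l)" for n
  proof -
    have "f n \<le> C * (n + 1) ^ (k + l)"
      by (rule order_trans[OF f]) (intro mult_left_mono power_increasing, auto)
    moreover have "g n \<le> D * (n + 1) ^ (k + l)"
      by (rule order_trans[OF g]) (intro mult_left_mono power_increasing, auto)
    ultimately show ?thesis by (simp add: add_mult_distrib)
  qed
  then show ?thesis unfolding poly_bounded_def by blast
qed

lemma poly_bounded_mult:
  assumes "poly_bounded f" "poly_bounded g"
  shows "poly_bounded (\<lambda>n. f n * g n)"
proof -
  obtain C k D l where f: "\<And>n. f n \<le> C * (n + 1) ^ k" and g: "\<And>n. g n \<le> D * (n + 1) ^ l"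
    using assms unfolding poly_bounded_def by metis
  have "f n * g n \<le> (C * D) * (n + 1) ^ (k + l)" for n
    using mult_mono[OF f[of n] g[of n]] by (simp add: power_add algebra_simps)
  then show ?thesis unfolding poly_bounded_def by blast
qed

lemma poly_bounded_power: "poly_bounded f \<Longrightarrow> poly_bounded (\<lambda>n. f n ^ m)"
  by (induction m) (auto intro: poly_bounded_const poly_bounded_mult)

lemma poly_bounded_compose:
  assumes "poly_bounded f" "poly_bounded g"
  shows "poly_bounded (\<lambda>n. f (g n))"
proof -
  obtain C k where f: "\<And>n. f n \<le> C * (n + 1) ^ k"
    using assms unfolding poly_bounded_def by metis
  have "poly_bounded (\<lambda>n. C * (g n + 1) ^ k)"
    by (intro poly_bounded_mult poly_bounded_power poly_bounded_add poly_bounded_const assms)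
  then obtain D l where "\<And>n. C * (g n + 1) ^ k \<le> D * (n + 1) ^ l"
    unfolding poly_bounded_def by blast
  then have "\<And>n. f (g n) \<le> D * (n + 1) ^ l" using f order_trans by blast
  then show ?thesis unfolding poly_bounded_def by blast
qed

lemmas poly_bounded_intros =
  poly_bounded_const poly_bounded_id poly_bounded_add poly_bounded_mult poly_bounded_power

text \<open>Reducing u modulo \<open>\<bar>b\<bar>\<close> bounds it directly; the identity then
  forces v b to be at most a b in absolute value, which bounds v by a.\<close>

lemma bezout_bounded:
  fixes a b :: int
  assumes "\<bar>a\<bar> \<le> B" "\<bar>b\<bar> \<le> B" "B \<ge> 1"
  obtains u v where "u * a + v * b = gcd a b" "\<bar>u\<bar> \<le> B" "\<bar>v\<bar> \<le> B"
proof (cases "a = 0 \<or> b = 0")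
  case True
  then show thesis
  proof
    assume "a = 0"
    then show thesis using assms(3) by (intro that[of 0 "sgn b"]) (auto simp: sgn_if)
  next
    assume "b = 0"
    then show thesis using assms(3) by (intro that[of "sgn a" 0]) (auto simp: sgn_if)
  qed
next
  case False
  obtain u0 v0 where uv: "u0 * a + v0 * b = gcd a b" using bezout_int by blast
  define u where "u = u0 mod \<bar>b\<bar>"
  have u: "0 \<le> u" "u < \<bar>b\<bar>" using False by (simp_all add: u_def)
  have "b dvd u0 - u" unfolding u_def by (metis abs_dvd_iff minus_mod_eq_mult_div dvd_triv_left)
  then obtain r where r: "u0 - u = b * r" by (elim dvdE)
  define v where "v = v0 + r * a"
  have eq: "u * a + v * b = gcd a b"
    using uv r by (simp add: v_def algebra_simps)
  have "gcd a b \<le> \<bar>a\<bar>" using False by (simp add: zdvd_imp_le[of _ "\<bar>a\<bar>"])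
  moreover have "0 \<le> gcd a b" by simp
  moreover have ua: "\<bar>u * a\<bar> \<le> (\<bar>b\<bar> - 1) * \<bar>a\<bar>"
    using u by (simp add: abs_mult mult_right_mono)
  moreover have "v * b = gcd a b - u * a" using eq by simp
  ultimately have "\<bar>v * b\<bar> \<le> \<bar>a\<bar> + (\<bar>b\<bar> - 1) * \<bar>a\<bar>" by linarith
  then have "\<bar>v\<bar> * \<bar>b\<bar> \<le> \<bar>a\<bar> * \<bar>b\<bar>" by (simp add: abs_mult algebra_simps)
  then have "\<bar>v\<bar> \<le> \<bar>a\<bar>" using False by simp
  then show thesis using that[OF eq] u assms by simp
qed

section \<open>Words of bounded length and central sequences\<close>

text \<open>An upper bound instead of the least length: it is monotone in n, composes under products
  and substitutions, and makes sense without knowing that A generates the group.\<close>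

definition word_le :: "('a, 'b) monoid_scheme \<Rightarrow> 'a set \<Rightarrow> nat \<Rightarrow> 'a \<Rightarrow> bool" where
  "word_le G A n g \<longleftrightarrow> (\<exists>w. length w \<le> n \<and> snd ` set w \<subseteq> A \<and> word_eval G w = g)"

definition comm :: "('a, 'b) monoid_scheme \<Rightarrow> 'a \<Rightarrow> 'a \<Rightarrow> 'a" where
  "comm G x y = x \<otimes>\<^bsub>G\<^esub> y \<otimes>\<^bsub>G\<^esub> inv\<^bsub>G\<^esub> x \<otimes>\<^bsub>G\<^esub> inv\<^bsub>G\<^esub> y"

text \<open>The subgroups generated by the suffixes form a central series with cyclic factors.\<close>

fun central_seq :: "('a, 'b) monoid_scheme \<Rightarrow> 'a list \<Rightarrow> bool" where
  "central_seq G [] = True"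
| "central_seq G (x # ys) \<longleftrightarrow> x \<in> carrier G \<and>
     (\<forall>g \<in> carrier G. comm G g x \<in> generate G (set ys)) \<and> central_seq G ys"

lemma word_le_one: "word_le G A n \<one>\<^bsub>G\<^esub>"
  unfolding word_le_def by (intro exI[of _ "[]"]) simp

lemma word_le_pos:
  assumes "x \<in> A" "word_le G A n g" shows "word_le G A (Suc n) (x \<otimes>\<^bsub>G\<^esub> g)"
proof -
  obtain w where "length w \<le> n" "snd ` set w \<subseteq> A" "word_eval G w = g"
    using assms unfolding word_le_def by blast
  then show ?thesis using assms unfolding word_le_def by (intro exI[of _ "(True, x) # w"]) simp
qed

lemma word_le_neg:
  assumes "x \<in> A" "word_le G A n g" shows "word_le G A (Suc n) (inv\<^bsub>G\<^esub> x \<otimes>\<^bsub>G\<^esub> g)"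
proof -
  obtain w where "length w \<le> n" "snd ` set w \<subseteq> A" "word_eval G w = g"
    using assms unfolding word_le_def by blast
  then show ?thesis using assms unfolding word_le_def by (intro exI[of _ "(False, x) # w"]) simp
qed

text \<open>Letters are stripped from the left. The base case is required for every n because the
  bound may exceed the actual length of the word.\<close>

lemma word_le_induct [consumes 1, case_names one pos neg]:
  assumes "word_le G A n g"
    and "\<And>n. P n \<one>\<^bsub>G\<^esub>"
    and "\<And>x n g. \<lbrakk>x \<in> A; word_le G A n g; P n g\<rbrakk> \<Longrightarrow> P (Suc n) (x \<otimes>\<^bsub>G\<^esub> g)"
    and "\<And>x n g. \<lbrakk>x \<in> A; word_le G A n g; P n g\<rbrakk> \<Longrightarrow> P (Suc n) (inv\<^bsub>G\<^esub> x \<otimes>\<^bsub>G\<^esub> g)"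
  shows "P n g"
proof -
  obtain w where "length w \<le> n" "snd ` set w \<subseteq> A" "word_eval G w = g"
    using assms(1) unfolding word_le_def by blast
  then show ?thesis
  proof (induction w arbitrary: n g)
    case Nil
    then show ?case using assms(2) by auto
  next
    case (Cons a w)
    obtain e x where a: "a = (e, x)" by fastforce
    obtain m where m: "n = Suc m" "length w \<le> m" using Cons.prems by (cases n) auto
    have x: "x \<in> A" and w: "snd ` set w \<subseteq> A" using Cons.prems a by auto
    have "word_le G A m (word_eval G w)" unfolding word_le_def using m w by blast
    moreover have "P m (word_eval G w)" using Cons.IH m w by blast
    ultimately show ?case
      using assms(3,4)[OF x] Cons.prems(3) unfolding m(1) a by (cases e) auto
  qed
qed

lemma word_le_mono: "word_le G A n g \<Longrightarrow> n \<le> m \<Longrightarrow> word_le G A m g"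
  unfolding word_le_def by (elim exE) (rule exI, force)

lemma word_le_mono_set: "word_le G A n g \<Longrightarrow> A \<subseteq> Y \<Longrightarrow> word_le G Y n g"
  unfolding word_le_def using subset_trans[of _ A Y] by auto

section \<open>Calculus of bounded words and normal subgroups\<close>

context group
begin

lemma mult_inv_cancel [simp]:
  "\<lbrakk>x \<in> carrier G; y \<in> carrier G\<rbrakk> \<Longrightarrow> x \<otimes> (inv x \<otimes> y) = y"
  "\<lbrakk>x \<in> carrier G; y \<in> carrier G\<rbrakk> \<Longrightarrow> inv x \<otimes> (x \<otimes> y) = y"
  by (simp_all add: m_assoc[symmetric])

lemma comm_closed [simp]: "\<lbrakk>x \<in> carrier G; y \<in> carrier G\<rbrakk> \<Longrightarrow> comm G x y \<in> carrier G"
  by (simp add: comm_def)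

lemma word_le_closed: "word_le G A n g \<Longrightarrow> A \<subseteq> carrier G \<Longrightarrow> g \<in> carrier G"
  by (induction rule: word_le_induct) auto

lemma word_le_mult:
  "word_le G A n g \<Longrightarrow> A \<subseteq> carrier G \<Longrightarrow> word_le G A m h \<Longrightarrow> word_le G A (n + m) (g \<otimes> h)"
proof (induction rule: word_le_induct)
  case (one n)
  then show ?case by (auto intro: word_le_mono simp: word_le_closed)
next
  case (pos x n g)
  then have "x \<in> carrier G" "g \<in> carrier G" "h \<in> carrier G" by (auto intro: word_le_closed)
  then show ?case using word_le_pos[OF pos(1) pos.IH[OF pos.prems]] by (simp add: m_assoc)
next
  case (neg x n g)
  then have "x \<in> carrier G" "g \<in> carrier G" "h \<in> carrier G" by (auto intro: word_le_closed)
  then show ?case using word_le_neg[OF neg(1) neg.IH[OF neg.prems]] by (simp add: m_assoc)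
qed

lemma word_le_base: "x \<in> A \<Longrightarrow> A \<subseteq> carrier G \<Longrightarrow> word_le G A 1 x"
  using word_le_pos[OF _ word_le_one, of x A G 0] by (auto dest: subsetD)

lemma word_le_base_inv: "x \<in> A \<Longrightarrow> A \<subseteq> carrier G \<Longrightarrow> word_le G A 1 (inv x)"
  using word_le_neg[OF _ word_le_one, of x A G 0] by (auto dest: subsetD)

lemma word_le_inv: "word_le G A n g \<Longrightarrow> A \<subseteq> carrier G \<Longrightarrow> word_le G A n (inv g)"
proof (induction rule: word_le_induct)
  case (one n)
  then show ?case by (auto intro: word_le_one)
next
  case (pos x n g)
  then have "x \<in> carrier G" "g \<in> carrier G" by (auto intro: word_le_closed)
  then show ?case
    using word_le_mult[OF pos.IH _ word_le_base_inv[OF pos(1)]] pos.prems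
    by (simp add: inv_mult_group)
next
  case (neg x n g)
  then have "x \<in> carrier G" "g \<in> carrier G" by (auto intro: word_le_closed)
  then show ?case
    using word_le_mult[OF neg.IH _ word_le_base[OF neg(1)]] neg.prems
    by (simp add: inv_mult_group)
qed

lemma word_le_nat_pow:
  "word_le G A n g \<Longrightarrow> A \<subseteq> carrier G \<Longrightarrow> word_le G A (k * n) (g [^] (k::nat))"
proof (induction k)
  case 0
  then show ?case by (simp add: word_le_one)
next
  case (Suc k)
  then show ?case using word_le_mult[OF Suc.IH _ Suc.prems(1)] by (simp add: add.commute)
qed

lemma word_le_int_pow:
  assumes "word_le G A n g" "A \<subseteq> carrier G"
  shows "word_le G A (nat \<bar>a\<bar> * n) (g [^] (a::int))"
proof (cases a rule: int_cases2)
  case (nonneg k)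
  then show ?thesis using word_le_nat_pow[OF assms, of k] by (simp add: int_pow_int)
next
  case (nonpos k)
  then show ?thesis
    using word_le_inv[OF word_le_nat_pow[OF assms, of k] assms(2)] word_le_closed[OF assms]
    by (simp add: int_pow_int int_pow_neg)
qed

lemma word_le_int_pow_le:
  assumes "word_le G A n g" "A \<subseteq> carrier G" "\<bar>a\<bar> \<le> int k"
  shows "word_le G A (k * n) (g [^] (a::int))"
  by (rule word_le_mono[OF word_le_int_pow[OF assms(1,2)]]) (use assms(3) in auto)

lemma word_le_imp_generate: "word_le G A n g \<Longrightarrow> g \<in> generate G A"
  by (induction rule: word_le_induct) (auto intro: generate.one generate.eng[OF generate.incl] generate.eng[OF generate.inv])

lemma generate_imp_word_le:
  assumes "g \<in> generate G A" "A \<subseteq> carrier G"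
  shows "\<exists>n. word_le G A n g"
  using assms
proof (induction rule: generate.induct)
  case (eng h1 h2)
  then show ?case using word_le_mult by blast
qed (auto intro: word_le_one word_le_base word_le_base_inv)

lemma word_le_subst:
  "word_le G A n g \<Longrightarrow> Y \<subseteq> carrier G \<Longrightarrow> (\<And>x. x \<in> A \<Longrightarrow> word_le G Y c x) \<Longrightarrow>
   word_le G Y (c * n) g"
proof (induction rule: word_le_induct)
  case (one n)
  then show ?case by (auto intro: word_le_one)
next
  case (pos x n g)
  then show ?case using word_le_mult[of Y c x "c * n" g] by simp
next
  case (neg x n g)
  then show ?case using word_le_mult[OF word_le_inv, of Y c x "c * n" g] by simp
qed

lemma word_le_change_generators:
  assumes "finite A" "A \<subseteq> generate G Y" "Y \<subseteq> carrier G"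
  shows "\<exists>c. \<forall>n g. word_le G A n g \<longrightarrow> word_le G Y (c * n) g"
proof -
  have "\<forall>x\<in>A. \<exists>n. word_le G Y n x" using assms generate_imp_word_le by blast
  then obtain l where l: "\<And>x. x \<in> A \<Longrightarrow> word_le G Y (l x) x" by metis
  \<comment> \<open>The sum over the finite set A serves as one length bound for all its
    elements.\<close>
  have "word_le G Y (\<Sum>x\<in>A. l x) x" if "x \<in> A" for x
    by (rule word_le_mono[OF l[OF that]]) (use assms that in \<open>auto intro: member_le_sum\<close>)
  then show ?thesis using word_le_subst assms by blast
qed

lemma word_le_conj:
  assumes "word_le G A n g" "A \<subseteq> carrier G" "x \<in> carrier G" "Y \<subseteq> carrier G"
    "\<And>y. y \<in> A \<Longrightarrow> word_le G Y c (x \<otimes> y \<otimes> inv x)"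
  shows "word_le G Y (c * n) (x \<otimes> g \<otimes> inv x)"
  using assms
proof (induction rule: word_le_induct)
  case (one n)
  then show ?case by (auto intro: word_le_one)
next
  case (pos y n g)
  then have c: "y \<in> carrier G" "g \<in> carrier G" by (auto intro: word_le_closed)
  have "word_le G Y (c + c * n) ((x \<otimes> y \<otimes> inv x) \<otimes> (x \<otimes> g \<otimes> inv x))"
    using pos by (intro word_le_mult) auto
  then show ?case using c pos.prems by (simp add: m_assoc)
next
  case (neg y n g)
  then have c: "y \<in> carrier G" "g \<in> carrier G" by (auto intro: word_le_closed)
  have "word_le G Y (c + c * n) (inv (x \<otimes> y \<otimes> inv x) \<otimes> (x \<otimes> g \<otimes> inv x))"
    using neg by (intro word_le_mult word_le_inv) auto
  then show ?case using c neg.prems by (simp add: m_assoc inv_mult_group)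
qed

lemma conj_generate:
  assumes "h \<in> generate G A" "A \<subseteq> carrier G" "g \<in> carrier G" "subgroup K G"
    "\<And>x. x \<in> A \<Longrightarrow> g \<otimes> x \<otimes> inv g \<in> K"
  shows "g \<otimes> h \<otimes> inv g \<in> K"
  using assms(1)
proof (induction rule: generate.induct)
  case one
  then show ?case using assms by (simp add: subgroup.one_closed)
next
  case (incl h)
  then show ?case using assms by blast
next
  case (inv h)
  then have "h \<in> carrier G" using assms by blast
  moreover have "inv (g \<otimes> h \<otimes> inv g) \<in> K" using assms inv by (simp add: subgroup.m_inv_closed)
  ultimately show ?case using assms by (simp add: m_assoc inv_mult_group)
next
  case (eng h1 h2)
  then have "h1 \<in> carrier G" "h2 \<in> carrier G" using assms(2) generate_in_carrier by blast+
  moreover have "(g \<otimes> h1 \<otimes> inv g) \<otimes> (g \<otimes> h2 \<otimes> inv g) \<in> K"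
    using assms eng by (simp add: subgroup.m_closed)
  ultimately show ?case using assms by (simp add: m_assoc)
qed

lemma normalI:
  assumes "subgroup H G" "\<And>g h. g \<in> carrier G \<Longrightarrow> h \<in> H \<Longrightarrow> comm G g h \<in> H"
  shows "H \<lhd> G"
proof -
  have "g \<otimes> h \<otimes> inv g \<in> H" if "g \<in> carrier G" "h \<in> H" for g h
  proof -
    have "h \<in> carrier G" using assms(1) that subgroup.mem_carrier by fast
    then have "g \<otimes> h \<otimes> inv g = comm G g h \<otimes> h" using that by (simp add: comm_def m_assoc)
    then show ?thesis using assms that by (simp add: subgroup.m_closed)
  qed
  then show ?thesis using assms(1) by (simp add: normal_inv_iff)
qed

lemma comm_mem_normal:
  assumes "H \<lhd> G" "g \<in> carrier G" "h \<in> H" shows "comm G g h \<in> H"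
  using assms normal.inv_op_closed2[OF assms] normal_imp_subgroup[OF assms(1)]
  by (simp add: comm_def subgroup.m_closed subgroup.m_inv_closed)

lemma central_seq_carrier: "central_seq G xs \<Longrightarrow> set xs \<subseteq> carrier G"
  by (induction xs) auto

lemma central_seq_append: "central_seq G (xs @ ys) \<Longrightarrow> central_seq G ys"
  by (induction xs) auto

text \<open>Conjugation moves each generator y only by the factor [g, y], which already lies in the
  subgroup of the shorter suffix.\<close>

lemma central_seq_normal: "central_seq G xs \<Longrightarrow> generate G (set xs) \<lhd> G"
proof (induction xs)
  case Nil
  then show ?case by (simp add: generate_empty one_is_normal)
next
  case (Cons x ys)
  let ?K = "generate G (set (x # ys))"
  have c: "set (x # ys) \<subseteq> carrier G" using Cons.prems central_seq_carrier by blast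
  have sub: "subgroup ?K G" using c by (rule generate_is_subgroup)
  have le: "generate G (set ys) \<subseteq> ?K" by (rule mono_generate) auto
  have n: "generate G (set ys) \<lhd> G" using Cons by simp
  have "g \<otimes> h \<otimes> inv g \<in> ?K" if g: "g \<in> carrier G" and h: "h \<in> ?K" for g h
  proof (rule conj_generate[OF h c g sub])
    fix y assume y: "y \<in> set (x # ys)"
    then have yc: "y \<in> carrier G" using c by blast
    have "comm G g y \<in> generate G (set ys)"
    proof (cases "y = x")
      case True
      then show ?thesis using Cons.prems g by simp
    next
      case False
      then show ?thesis using y by (intro comm_mem_normal[OF n g] generate.incl) simp
    qed
    then have "comm G g y \<otimes> y \<in> ?K"
      using le y by (intro subgroup.m_closed[OF sub]) (auto intro: generate.incl)
    then show "g \<otimes> y \<otimes> inv g \<in> ?K" using yc g by (simp add: comm_def m_assoc)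
  qed
  then show ?case using sub by (simp add: normal_inv_iff)
qed

section \<open>Conjugation by powers, collection and distortion\<close>

text \<open>Writing x y x^-1 = y z with z in the subgroup of the shorter suffix gives x^(a+1) y
  x^-(a+1) = (x^a y x^-a)(x^a z x^-a). The second factor is polynomially long by induction, so
  summing over a raises the degree by at most one per generator.\<close>

lemma conj_power_bound:
  assumes "central_seq G ys" "x \<in> carrier G"
  shows "\<exists>p. poly_bounded p \<and> mono p \<and>
    (\<forall>a. \<forall>y\<in>set ys. word_le G (set ys) (p a) (x [^] (a::nat) \<otimes> y \<otimes> inv (x [^] a)))"
  using assms(1)
proof (induction ys)
  case Nil
  show ?case by (intro exI[of _ "\<lambda>_. 0"]) (auto intro: poly_bounded_const monoI)
next
  case (Cons y zs)
  then obtain p where p: "poly_bounded p" "mono p"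
    "\<And>a z. z \<in> set zs \<Longrightarrow> word_le G (set zs) (p a) (x [^] a \<otimes> z \<otimes> inv (x [^] a))" by auto
  have c: "set (y # zs) \<subseteq> carrier G" using Cons.prems central_seq_carrier by blast
  then have yc: "y \<in> carrier G" and zc: "set zs \<subseteq> carrier G" by auto
  have n: "generate G (set zs) \<lhd> G" using Cons.prems central_seq_normal by simp
  define z where "z = inv y \<otimes> comm G x y \<otimes> y"
  have zcar: "z \<in> carrier G" unfolding z_def using yc assms(2) by simp
  have yz: "x \<otimes> y \<otimes> inv x = y \<otimes> z"
    using yc assms(2) by (simp add: z_def comm_def m_assoc)
  have "z \<in> generate G (set zs)"
    unfolding z_def using normal.inv_op_closed1[OF n yc] Cons.prems assms(2) by simp
  then obtain l where l: "word_le G (set zs) l z" using generate_imp_word_le zc by blast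
  have z: "word_le G (set (y # zs)) (p a * l) (x [^] a \<otimes> z \<otimes> inv (x [^] a))" for a
    by (rule word_le_mono_set[OF word_le_conj[OF l zc _ zc p(3)]]) (auto simp: assms)
  \<comment> \<open>All a summands are estimated by the last one, which is where monotonicity of p
    enters.\<close>
  have y: "word_le G (set (y # zs)) (1 + a * (p a * l)) (x [^] a \<otimes> y \<otimes> inv (x [^] a))" for a
  proof (induction a)
    case 0
    then show ?case using word_le_base[of y "set (y # zs)"] c yc by simp
  next
    case (Suc a)
    have "x [^] Suc a \<otimes> y \<otimes> inv (x [^] Suc a) = x [^] a \<otimes> (x \<otimes> y \<otimes> inv x) \<otimes> inv (x [^] a)"
      using assms(2) yc by (simp add: inv_mult_group m_assoc)
    also have "\<dots> = (x [^] a \<otimes> y \<otimes> inv (x [^] a)) \<otimes> (x [^] a \<otimes> z \<otimes> inv (x [^] a))"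
      unfolding yz using assms(2) yc zcar by (simp add: m_assoc)
    finally have eq: "x [^] Suc a \<otimes> y \<otimes> inv (x [^] Suc a) = \<dots>" .
    have "p a \<le> p (Suc a)" using p(2) by (simp add: monoD)
    then have "Suc a * (p a * l) \<le> Suc a * (p (Suc a) * l)"
      by (intro mult_le_mono order_refl)
    then have "1 + a * (p a * l) + p a * l \<le> 1 + Suc a * (p (Suc a) * l)" by simp
    with word_le_mult[OF Suc c z[of a]] show ?case unfolding eq by (rule word_le_mono)
  qed
  \<comment> \<open>The first two summands serve y, the last one serves the generators in
    \<open>zs\<close>.\<close>
  let ?p = "\<lambda>a. 1 + a * (p a * l) + p a"
  have "mono ?p" by (intro monoI add_mono mult_mono monoD[OF p(2)]) auto
  moreover have "poly_bounded ?p" by (intro poly_bounded_intros p(1))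
  moreover have "word_le G (set (y # zs)) (?p a) (x [^] a \<otimes> w \<otimes> inv (x [^] a))"
    if "w \<in> set (y # zs)" for a w
  proof (cases "w = y")
    case True
    then show ?thesis using word_le_mono[OF y[of a], of "?p a"] by simp
  next
    case False
    then have "word_le G (set zs) (p a) (x [^] a \<otimes> w \<otimes> inv (x [^] a))" using that p(3) by simp
    then have "word_le G (set (y # zs)) (p a) (x [^] a \<otimes> w \<otimes> inv (x [^] a))"
      by (rule word_le_mono_set) auto
    then show ?thesis by (rule word_le_mono) simp
  qed
  ultimately show ?case by (intro exI[of _ ?p]) blast
qed

lemma normal_swap:
  assumes "H \<lhd> G" "w \<in> H" "g \<in> carrier G"
  obtains w' where "w' \<in> H" "w \<otimes> g = g \<otimes> w'"
proof (rule that)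
  have "w \<in> carrier G" using assms normal_imp_subgroup subgroup.mem_carrier by fast
  then show "w \<otimes> g = g \<otimes> (inv g \<otimes> w \<otimes> g)" using assms(3) by (simp add: m_assoc)
  show "inv g \<otimes> w \<otimes> g \<in> H" using normal.inv_op_closed1[OF assms(1,3,2)] .
qed

text \<open>The elements commuting with g modulo H form a subgroup: [g, h k] = [g, h] (h [g, k]
  h^-1) and [g, h^-1] = h^-1 [g, h]^-1 h, and H is normal.\<close>

lemma comm_mem_generate:
  assumes "H \<lhd> G" "g \<in> carrier G" "A \<subseteq> carrier G" "u \<in> generate G A"
    and "\<And>a. a \<in> A \<Longrightarrow> comm G g a \<in> H"
  shows "comm G g u \<in> H"
  using assms(4)
proof (induction rule: generate.induct)
  case one
  then show ?case using assms normal_imp_subgroup subgroup.one_closed by (fastforce simp: comm_def)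
next
  case (incl h)
  then show ?case using assms by blast
next
  case (inv h)
  then have h: "h \<in> carrier G" using assms by blast
  have "inv h \<otimes> inv (comm G g h) \<otimes> h \<in> H"
    using assms(5)[OF inv] normal.inv_op_closed1[OF assms(1) h]
      subgroup.m_inv_closed[OF normal_imp_subgroup[OF assms(1)]] by blast
  moreover have "inv h \<otimes> inv (comm G g h) \<otimes> h = comm G g (inv h)"
    using h assms(2) by (simp add: comm_def m_assoc inv_mult_group)
  ultimately show ?case by simp
next
  case (eng h1 h2)
  then have h: "h1 \<in> carrier G" "h2 \<in> carrier G"
    using assms(3) generate_in_carrier by blast+
  have "comm G g h1 \<otimes> (h1 \<otimes> comm G g h2 \<otimes> inv h1) \<in> H"
    using eng.IH normal.inv_op_closed2[OF assms(1) h(1)]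
      subgroup.m_closed[OF normal_imp_subgroup[OF assms(1)]] by blast
  moreover have "comm G g h1 \<otimes> (h1 \<otimes> comm G g h2 \<otimes> inv h1) = comm G g (h1 \<otimes> h2)"
    using h assms(2) by (simp add: comm_def m_assoc inv_mult_group)
  ultimately show ?case by simp
qed

text \<open>Here q is the order of x modulo H, with q = 0 encoding infinite order, so that
  divisibility covers both cases.\<close>

lemma exponents_multiples:
  assumes "subgroup H G" "x \<in> carrier G"
  obtains q :: nat where "\<And>a::int. x [^] a \<in> H \<longleftrightarrow> int q dvd a"
proof (cases "\<exists>n>0. x [^] (n::nat) \<in> H")
  case True
  define q where "q = (LEAST n. n > 0 \<and> x [^] (n::nat) \<in> H)"
  have q: "q > 0" "x [^] q \<in> H" using LeastI_ex[OF True] unfolding q_def by auto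
  have least: "q \<le> n" if "n > 0" "x [^] n \<in> H" for n
    unfolding q_def using that by (simp add: Least_le)
  have mult: "x [^] (int q * b) \<in> H" for b
    using subgroup_int_pow_closed[OF assms(1) q(2), of b] assms(2)
    by (simp add: int_pow_int[symmetric] int_pow_pow)
  have "int q dvd a" if "x [^] a \<in> H" for a :: int
  proof -
    have "x [^] (a + int q * - (a div int q)) \<in> H"
      using subgroup.m_closed[OF assms(1) that mult]
      by (simp only: int_pow_mult[OF assms(2)])
    moreover have "a + int q * - (a div int q) = a mod int q"
      by (simp add: minus_mult_div_eq_mod)
    ultimately have "x [^] (a mod int q) \<in> H" by metis
    moreover have "a mod int q = int (nat (a mod int q))" using q by simp
    ultimately have "x [^] nat (a mod int q) \<in> H" by (metis int_pow_int)
    moreover have "nat (a mod int q) < q" using q by (simp add: nat_less_iff)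
    ultimately have "nat (a mod int q) = 0" using least by (meson not_gr_zero not_le)
    then have "a mod int q = 0" using q by (simp add: nat_eq_iff)
    then show ?thesis by (simp add: dvd_eq_mod_eq_0)
  qed
  then show thesis using that[of q] mult by (auto elim!: dvdE)
next
  case False
  have "a = 0" if "x [^] a \<in> H" for a :: int
  proof (rule ccontr)
    assume "a \<noteq> 0"
    have "x [^] nat \<bar>a\<bar> \<in> H"
    proof (cases a rule: int_cases2)
      case (nonneg k)
      then show ?thesis using that by (simp add: int_pow_int)
    next
      case (nonpos k)
      then show ?thesis using subgroup.m_inv_closed[OF assms(1) that] assms(2)
        by (simp add: int_pow_int int_pow_neg)
    qed
    moreover have "nat \<bar>a\<bar> > 0" using \<open>a \<noteq> 0\<close> by simp
    ultimately show False using False by blast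
  qed
  then show thesis using that[of 0] assms subgroup.one_closed by fastforce
qed

text \<open>A letter y from \<open>ys\<close> is carried past the collected power by y x^a = x^a
  (x^-a y x^a). Since a never exceeds the number of letters read, each passage costs a polynomially
  bounded number of letters.\<close>

lemma collect_first:
  assumes "central_seq G (x # ys)"
  shows "\<exists>p. poly_bounded p \<and> (\<forall>n g. word_le G (set (x # ys)) n g \<longrightarrow>
    (\<exists>a w. \<bar>a\<bar> \<le> int n \<and> word_le G (set ys) (p n) w \<and> g = x [^] a \<otimes> w))"
proof -
  have x: "x \<in> carrier G" and c: "set ys \<subseteq> carrier G" and cs: "central_seq G ys"
    using assms central_seq_carrier by auto
  obtain p1 where p1: "poly_bounded p1" "mono p1"
    "\<And>a y. y \<in> set ys \<Longrightarrow> word_le G (set ys) (p1 a) (x [^] (a::nat) \<otimes> y \<otimes> inv (x [^] a))"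
    using conj_power_bound[OF cs x] by blast
  obtain p2 where p2: "poly_bounded p2" "mono p2"
    "\<And>a y. y \<in> set ys \<Longrightarrow>
      word_le G (set ys) (p2 a) (inv x [^] (a::nat) \<otimes> y \<otimes> inv (inv x [^] a))"
    using conj_power_bound[OF cs inv_closed[OF x]] by blast
  \<comment> \<open>The conjugation bound concerns natural exponents, so x and its inverse are
    treated separately and the two bounds added.\<close>
  define q where "q N = p1 N + p2 N" for N
  have q: "word_le G (set ys) (q N) (x [^] (- a) \<otimes> y \<otimes> x [^] a)"
    if "y \<in> set ys" "\<bar>a\<bar> \<le> int N" for a :: int and y N
  proof (cases a rule: int_cases2)
    case (nonneg k)
    then have "x [^] (- a) \<otimes> y \<otimes> x [^] a = inv x [^] k \<otimes> y \<otimes> inv (inv x [^] k)"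
      using x by (simp add: int_pow_int int_pow_neg nat_pow_inv)
    moreover have "p2 k \<le> q N" using monoD[OF p2(2), of k N] that nonneg by (simp add: q_def)
    ultimately show ?thesis using word_le_mono[OF p2(3)[OF that(1)]] by metis
  next
    case (nonpos k)
    then have "x [^] (- a) \<otimes> y \<otimes> x [^] a = x [^] k \<otimes> y \<otimes> inv (x [^] k)"
      using x by (simp add: int_pow_int int_pow_neg)
    moreover have "p1 k \<le> q N" using monoD[OF p1(2), of k N] that nonpos by (simp add: q_def)
    ultimately show ?thesis using word_le_mono[OF p1(3)[OF that(1)]] by metis
  qed
  \<comment> \<open>Fixing N while n grows keeps the cost per letter constant during the induction;
    N = n is chosen at the end.\<close>
  have key: "\<exists>a w. \<bar>a\<bar> \<le> int n \<and> word_le G (set ys) (n * q N) w \<and> g = x [^] a \<otimes> w"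
    if "word_le G (set (x # ys)) n g" "n \<le> N" for n g N
    using that
  proof (induction rule: word_le_induct)
    case (one n)
    show ?case by (intro exI[of _ 0] exI[of _ \<one>]) (simp add: word_le_one)
  next
    case (pos y n g)
    then obtain a w where aw: "\<bar>a\<bar> \<le> int n" "word_le G (set ys) (n * q N) w" "g = x [^] a \<otimes> w"
      by auto
    have w: "w \<in> carrier G" using aw(2) c word_le_closed by blast
    show ?case
    proof (cases "y = x")
      case True
      have "x \<otimes> g = x [^] (1 + a) \<otimes> w"
        using aw(3) x w by (simp add: int_pow_mult m_assoc)
      then show ?thesis using aw True word_le_mono[OF aw(2), of "Suc n * q N"]
        by (intro exI[of _ "1 + a"] exI[of _ w]) auto
    next
      case False
      then have y: "y \<in> set ys" "y \<in> carrier G" using pos c by auto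
      have "y \<otimes> g = x [^] a \<otimes> ((x [^] (- a) \<otimes> y \<otimes> x [^] a) \<otimes> w)"
        using aw(3) x w y by (simp add: int_pow_neg m_assoc)
      moreover have "word_le G (set ys) (q N + n * q N) ((x [^] (- a) \<otimes> y \<otimes> x [^] a) \<otimes> w)"
        using word_le_mult[OF q[OF y(1)] c aw(2)] aw(1) pos.prems by simp
      ultimately show ?thesis using aw(1) by (intro exI[of _ a] exI) auto
    qed
  next
    case (neg y n g)
    then obtain a w where aw: "\<bar>a\<bar> \<le> int n" "word_le G (set ys) (n * q N) w" "g = x [^] a \<otimes> w"
      by auto
    have w: "w \<in> carrier G" using aw(2) c word_le_closed by blast
    show ?case
    proof (cases "y = x")
      case True
      have "x [^] (-1 + a) = inv x \<otimes> x [^] a"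
        using x int_pow_mult[OF x, of "-1" a] int_pow_neg[OF x, of 1] by simp
      then have "inv x \<otimes> g = x [^] (-1 + a) \<otimes> w"
        using aw(3) x w by (simp add: m_assoc)
      then show ?thesis using aw True word_le_mono[OF aw(2), of "Suc n * q N"]
        by (intro exI[of _ "-1 + a"] exI[of _ w]) auto
    next
      case False
      then have y: "y \<in> set ys" "y \<in> carrier G" using neg c by auto
      have "inv y \<otimes> g = x [^] a \<otimes> (inv (x [^] (- a) \<otimes> y \<otimes> x [^] a) \<otimes> w)"
        using aw(3) x w y by (simp add: int_pow_neg m_assoc inv_mult_group)
      moreover have "word_le G (set ys) (q N + n * q N) (inv (x [^] (- a) \<otimes> y \<otimes> x [^] a) \<otimes> w)"
        using word_le_mult[OF word_le_inv[OF q[OF y(1)] c] c aw(2)] aw(1) neg.prems by simp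
      ultimately show ?thesis using aw(1) by (intro exI[of _ a] exI) auto
    qed
  qed
  have "poly_bounded (\<lambda>n. n * q n)" unfolding q_def by (intro poly_bounded_intros p1 p2)
  then show ?thesis using key by (intro exI[of _ "\<lambda>n. n * q n"]) blast
qed

text \<open>After collection g = x^a w, membership of g forces x^a into the smaller subgroup, so a
  is a multiple of the order q. The fixed element x^q has a fixed word in \<open>ys\<close>, and at
  most n copies of it or of its inverse are used.\<close>

lemma distortion_tl:
  assumes "central_seq G (x # ys)"
  shows "\<exists>p. poly_bounded p \<and> (\<forall>n g. word_le G (set (x # ys)) n g \<longrightarrow>
    g \<in> generate G (set ys) \<longrightarrow> word_le G (set ys) (p n) g)"
proof -
  let ?M = "generate G (set ys)"
  have x: "x \<in> carrier G" and c: "set ys \<subseteq> carrier G"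
    using assms central_seq_carrier by auto
  have M: "subgroup ?M G" using c by (rule generate_is_subgroup)
  obtain p where p: "poly_bounded p" "\<And>n g. word_le G (set (x # ys)) n g \<Longrightarrow>
    \<exists>a w. \<bar>a\<bar> \<le> int n \<and> word_le G (set ys) (p n) w \<and> g = x [^] a \<otimes> w"
    using collect_first[OF assms] by blast
  obtain q :: nat where q: "\<And>a::int. x [^] a \<in> ?M \<longleftrightarrow> int q dvd a"
    using exponents_multiples[OF M x] by blast
  then have "x [^] int q \<in> ?M" by simp
  then obtain l where l: "word_le G (set ys) l (x [^] int q)" using generate_imp_word_le c by blast
  have "word_le G (set ys) (n * l + p n) g" if g: "word_le G (set (x # ys)) n g" "g \<in> ?M" for n g
  proof -
    obtain a w where aw: "\<bar>a\<bar> \<le> int n" "word_le G (set ys) (p n) w" "g = x [^] a \<otimes> w"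
      using p(2)[OF g(1)] by blast
    have w: "w \<in> carrier G" "w \<in> ?M" using aw(2) c word_le_closed word_le_imp_generate by blast+
    have "g \<otimes> inv w \<in> ?M"
      using subgroup.m_closed[OF M g(2)] subgroup.m_inv_closed[OF M w(2)] by blast
    then have "x [^] a \<in> ?M" using aw(3) w x by (simp add: m_assoc)
    then obtain b where b: "a = int q * b" using q by (auto elim: dvdE)
    \<comment> \<open>For q = 0 the multiplier b is arbitrary because a = 0; choosing 0 keeps it
      bounded.\<close>
    have "\<exists>b. a = int q * b \<and> \<bar>b\<bar> \<le> int n"
    proof (cases "q = 0")
      case True
      then show ?thesis using b by (intro exI[of _ 0]) simp
    next
      case False
      then have "1 * \<bar>b\<bar> \<le> int q * \<bar>b\<bar>" by (intro mult_right_mono) auto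
      then have "\<bar>b\<bar> \<le> \<bar>a\<bar>" using b by (simp add: abs_mult)
      then show ?thesis using b aw(1) by auto
    qed
    then obtain b where b: "a = int q * b" "\<bar>b\<bar> \<le> int n" by blast
    have "word_le G (set ys) (n * l) ((x [^] int q) [^] b)"
      by (rule word_le_int_pow_le[OF l c b(2)])
    then have "word_le G (set ys) (n * l) (x [^] a)" using x b(1) by (simp only: int_pow_pow)
    then show ?thesis unfolding aw(3) by (rule word_le_mult[OF _ c aw(2)])
  qed
  moreover have "poly_bounded (\<lambda>n. n * l + p n)" by (intro poly_bounded_intros p)
  ultimately show ?thesis by (intro exI[of _ "\<lambda>n. n * l + p n"]) blast
qed

lemma distortion_suffix:
  assumes "central_seq G (xs @ ys)"
  shows "\<exists>p. poly_bounded p \<and> (\<forall>n g. word_le G (set (xs @ ys)) n g \<longrightarrow>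
    g \<in> generate G (set ys) \<longrightarrow> word_le G (set ys) (p n) g)"
  using assms
proof (induction xs)
  case Nil
  show ?case by (intro exI[of _ "\<lambda>n. n"]) (simp add: poly_bounded_id)
next
  case (Cons x xs)
  then obtain p where p: "poly_bounded p" "\<And>n g. word_le G (set (xs @ ys)) n g \<Longrightarrow>
    g \<in> generate G (set ys) \<Longrightarrow> word_le G (set ys) (p n) g" by auto
  obtain r where r: "poly_bounded r" "\<And>n g. word_le G (set (x # xs @ ys)) n g \<Longrightarrow>
    g \<in> generate G (set (xs @ ys)) \<Longrightarrow> word_le G (set (xs @ ys)) (r n) g"
    using distortion_tl[of x "xs @ ys"] Cons.prems by auto
  have "generate G (set ys) \<subseteq> generate G (set (xs @ ys))" by (rule mono_generate) auto
  then have "word_le G (set ys) (p (r n)) g"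
    if "word_le G (set ((x # xs) @ ys)) n g" "g \<in> generate G (set ys)" for n g
    using that p(2) r(2) by auto
  then show ?case using poly_bounded_compose[OF p(1) r(1)]
    by (intro exI[of _ "\<lambda>n. p (r n)"]) blast
qed

lemma word_le_comm:
  assumes "word_le G A L g" "word_le G A L h" "A \<subseteq> carrier G"
  shows "word_le G A (4 * L) (comm G g h)"
proof -
  have "word_le G A (L + L + L + L) (comm G g h)"
    unfolding comm_def using assms by (intro word_le_mult word_le_inv)
  moreover have "L + L + L + L = 4 * L" by simp
  ultimately show ?thesis by (simp only:)
qed

section \<open>The lower central series and its refinement\<close>

lemma lower_central_Suc:
  "n > 0 \<Longrightarrow> lower_central G (Suc n) =
     generate G {comm G x y | x y. x \<in> carrier G \<and> y \<in> lower_central G n}"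
  by (cases n) (simp_all add: comm_def)

lemma comm_mem_lower_central:
  "\<lbrakk>n > 0; x \<in> carrier G; y \<in> lower_central G n\<rbrakk> \<Longrightarrow> comm G x y \<in> lower_central G (Suc n)"
  unfolding lower_central_Suc by (auto intro: generate.incl)

text \<open>The two claims feed each other: normality of the next term needs that it lies in the
  current one, and the next inclusion needs normality.\<close>

lemma lower_central_normal_decreasing:
  "n > 0 \<Longrightarrow> lower_central G n \<lhd> G \<and> lower_central G (Suc n) \<subseteq> lower_central G n"
proof (induction n rule: nat_induct_non_zero)
  case 1
  have "generate G {comm G x y | x y. x \<in> carrier G \<and> y \<in> lower_central G 1} \<subseteq> carrier G"
    by (rule generate_incl) auto
  then show ?case using lower_central_Suc[of 1] normal_self by simp
next
  case (Suc n)
  let ?L = "lower_central G"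
  have sub: "subgroup (?L (Suc n)) G"
    unfolding lower_central_Suc[OF Suc(1)]
    using subgroup.subset[OF normal_imp_subgroup[OF conjunct1[OF Suc.IH]]]
    by (intro generate_is_subgroup) auto
  have normal: "?L (Suc n) \<lhd> G"
    using Suc comm_mem_lower_central by (intro normalI sub) blast
  have "?L (Suc (Suc n)) \<subseteq> ?L (Suc n)"
    unfolding lower_central_Suc[OF zero_less_Suc]
    using comm_mem_normal[OF normal] by (intro generate_subgroup_incl sub) blast
  then show ?case using normal by blast
qed

lemma lower_central_normal: "n > 0 \<Longrightarrow> lower_central G n \<lhd> G"
  and lower_central_decreasing: "n > 0 \<Longrightarrow> lower_central G (Suc n) \<subseteq> lower_central G n"
  using lower_central_normal_decreasing by blast+

lemma lower_central_carrier: "n > 0 \<Longrightarrow> lower_central G n \<subseteq> carrier G"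
  using lower_central_normal normal_imp_subgroup subgroup.subset by blast

text \<open>Modulo the second next term the commutator is bilinear, so the next term is generated by
  the commutators [s, a] of generators.\<close>

lemma generate_lower_central_step:
  assumes n: "n > 0" and A: "finite A" "A \<subseteq> lower_central G n"
      "generate G (A \<union> lower_central G (Suc n)) = lower_central G n"
    and S: "finite S" "S \<subseteq> carrier G" "generate G S = carrier G"
  obtains B where "finite B" "B \<subseteq> lower_central G (Suc n)"
    "generate G (B \<union> lower_central G (Suc (Suc n))) = lower_central G (Suc n)"
proof
  let ?L = "lower_central G"
  let ?B = "(\<lambda>(s, a). comm G s a) ` (S \<times> A)"
  let ?Q = "generate G (?B \<union> ?L (Suc (Suc n)))"
  show "finite ?B" using A S by simp
  show B: "?B \<subseteq> ?L (Suc n)" 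
  proof clarify
    fix s a assume "s \<in> S" "a \<in> A"
    then show "comm G s a \<in> ?L (Suc n)"
      using A(2) S(2) by (intro comm_mem_lower_central[OF n]) auto
  qed
  have N: "?L (Suc n) \<lhd> G" by (rule lower_central_normal) simp
  have QL: "?Q \<subseteq> ?L (Suc n)"
    using B lower_central_decreasing[of "Suc n"]
    by (intro generate_subgroup_incl normal_imp_subgroup[OF N]) auto
  have c: "?B \<union> ?L (Suc (Suc n)) \<subseteq> carrier G"
    using B lower_central_carrier[of "Suc n"] lower_central_carrier[of "Suc (Suc n)"] by auto
  have LQ: "?L (Suc (Suc n)) \<subseteq> ?Q" by (auto intro: generate.incl)
  \<comment> \<open>Any subgroup between two consecutive terms of the series is normal.\<close>
  have Q: "?Q \<lhd> G"
    using comm_mem_lower_central[of "Suc n"] QL LQ by (intro normalI generate_is_subgroup c) blast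
  have "comm G s y \<in> ?Q" if s: "s \<in> S" and y: "y \<in> ?L n" for s y
  proof -
    have "comm G s a \<in> ?Q" if "a \<in> A \<union> ?L (Suc n)" for a
    proof (cases "a \<in> A")
      case True
      then show ?thesis using s by (auto intro!: generate.incl)
    next
      case False
      then show ?thesis using that s S comm_mem_lower_central[of "Suc n" s a] LQ by auto
    qed
    moreover have "A \<union> ?L (Suc n) \<subseteq> carrier G"
      using A lower_central_carrier[OF n] lower_central_carrier[of "Suc n"] by auto
    ultimately show ?thesis
      using s S(2) y A(3) by (intro comm_mem_generate[OF Q, of s "A \<union> ?L (Suc n)" y]) auto
  qed
  note sy = this
  \<comment> \<open>\<open>comm_mem_generate\<close> extends only the second argument from
    generators; exchanging the arguments, at the price of an inverse, lets it act on the first one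
    too.\<close>
  have swap: "comm G y g = inv (comm G g y)" if "y \<in> carrier G" "g \<in> carrier G" for y g
    using that by (simp add: comm_def m_assoc inv_mult_group)
  have ys: "comm G y s \<in> ?Q" if "s \<in> S" "y \<in> ?L n" for s y
    using swap[of y s] subgroup.m_inv_closed[OF normal_imp_subgroup[OF Q] sy[OF that]]
      subsetD[OF S(2) that(1)] subsetD[OF lower_central_carrier[OF n] that(2)] by (simp only:)
  have "comm G g y \<in> ?Q" if g: "g \<in> carrier G" and y: "y \<in> ?L n" for g y
  proof -
    have yc: "y \<in> carrier G" using y lower_central_carrier[OF n] by blast
    have "comm G y g \<in> ?Q"
      by (rule comm_mem_generate[OF Q yc S(2)]) (use g S(3) ys y in auto)
    from subgroup.m_inv_closed[OF normal_imp_subgroup[OF Q] this] show ?thesis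
      using swap[OF g yc] by (simp only:)
  qed
  then have "?L (Suc n) \<subseteq> ?Q"
    unfolding lower_central_Suc[OF n] by (intro generate_subgroup_incl normal_imp_subgroup[OF Q]) blast
  then show "?Q = ?L (Suc n)" using QL by blast
qed

lemma generate_lower_central:
  assumes S: "finite S" "S \<subseteq> carrier G" "generate G S = carrier G" and "n > 0"
  shows "\<exists>A. finite A \<and> A \<subseteq> lower_central G n \<and>
    generate G (A \<union> lower_central G (Suc n)) = lower_central G n"
  using assms(4)
proof (induction n rule: nat_induct_non_zero)
  case 1
  have "generate G (S \<union> lower_central G (Suc 1)) \<subseteq> carrier G"
    using S lower_central_carrier[of "Suc 1"] by (intro generate_incl) simp
  moreover have "generate G S \<subseteq> generate G (S \<union> lower_central G (Suc 1))"
    by (intro mono_generate) simp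
  ultimately show ?case using S by (intro exI[of _ S]) simp
next
  case (Suc n)
  then show ?case using generate_lower_central_step[OF Suc(1) _ _ _ S] by metis
qed

text \<open>Generators of the n-th term modulo the next can be prepended in any order: their
  commutators lie in the next term, which every longer suffix already generates.\<close>

lemma central_seq_extend:
  assumes S: "finite S" "S \<subseteq> carrier G" "generate G S = carrier G" and n: "n > 0"
    and ys: "central_seq G ys" "generate G (set ys) = lower_central G (Suc n)"
  obtains xs where "central_seq G (xs @ ys)" "generate G (set (xs @ ys)) = lower_central G n"
proof -
  let ?L = "lower_central G"
  obtain A where A: "finite A" "A \<subseteq> ?L n" "generate G (A \<union> ?L (Suc n)) = ?L n"
    using generate_lower_central[OF S n] by blast
  obtain xs where xs: "set xs = A" using finite_list[OF A(1)] by blast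
  have "central_seq G (zs @ ys)" if "set zs \<subseteq> A" for zs
    using that
  proof (induction zs)
    case Nil
    show ?case using ys by simp
  next
    case (Cons z zs)
    have "generate G (set ys) \<subseteq> generate G (set (zs @ ys))" by (intro mono_generate) simp
    then have "comm G g z \<in> generate G (set (zs @ ys))" if "g \<in> carrier G" for g
      using comm_mem_lower_central[OF n that, of z] Cons.prems A(2) ys(2) by auto
    then show ?case using Cons A(2) lower_central_carrier[OF n] by auto
  qed
  then have 1: "central_seq G (xs @ ys)" using xs by simp
  have sub: "subgroup (generate G (set (xs @ ys))) G"
    by (intro generate_is_subgroup central_seq_carrier 1)
  have "generate G (set ys) \<subseteq> generate G (set (xs @ ys))" by (intro mono_generate) simp
  then have "?L n \<subseteq> generate G (set (xs @ ys))"
    using ys(2) xs unfolding A(3)[symmetric] by (intro generate_subgroup_incl sub) (auto intro: generate.incl)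
  moreover have "generate G (set (xs @ ys)) \<subseteq> ?L n"
    using A(2) xs ys(2) lower_central_decreasing[OF n]
    by (intro generate_subgroup_incl normal_imp_subgroup lower_central_normal n)
       (auto intro: generate.incl)
  ultimately show thesis using that 1 by blast
qed

lemma central_seq_through_lower_central:
  assumes S: "finite S" "S \<subseteq> carrier G" "generate G S = carrier G"
    and c: "lower_central G c = {\<one>}" and i: "i > 0"
  obtains xs ys where "central_seq G (xs @ ys)" "generate G (set (xs @ ys)) = carrier G"
    "generate G (set ys) = lower_central G i"
proof -
  let ?L = "lower_central G"
  \<comment> \<open>Needed when i lies beyond c; the empty list then represents the i-th
    term.\<close>
  have bot: "?L n = {\<one>}" if "n \<ge> c" "n > 0" for n
    using that
  proof (induction n rule: dec_induct)
    case base
    then show ?case using c by simp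
  next
    case (step n)
    have "?L (Suc n) \<subseteq> {\<one>}"
    proof (cases "n = 0")
      case True
      then show ?thesis using step c by simp
    next
      case False
      then show ?thesis using step lower_central_decreasing[of n] by simp
    qed
    then show ?case
      using subgroup.one_closed[OF normal_imp_subgroup[OF lower_central_normal[of "Suc n"]]]
      by auto
  qed
  have "\<exists>ys. central_seq G ys \<and> generate G (set ys) = ?L n" if "n > 0" for n
  proof (cases "n \<ge> c")
    case True
    then show ?thesis using bot that by (intro exI[of _ "[]"]) (simp add: generate_empty)
  next
    case False
    then have "n \<le> c" by simp
    then show ?thesis using \<open>n > 0\<close>
    proof (induction n rule: inc_induct)
      case base
      then show ?case using c by (intro exI[of _ "[]"]) (simp add: generate_empty)
    next
      case (step n)
      then obtain ys where "central_seq G ys" "generate G (set ys) = ?L (Suc n)" by auto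
      from central_seq_extend[OF S step.prems this] show ?case by metis
    qed
  qed
  then obtain ys where ys: "central_seq G ys" "generate G (set ys) = ?L i" using i by blast
  \<comment> \<open>A second descent, from i to 1, keeps \<open>ys\<close> as a literal suffix, so
    that the i-th term is one of the suffix subgroups.\<close>
  have "\<exists>xs. central_seq G (xs @ ys) \<and> generate G (set (xs @ ys)) = ?L n"
    if "n \<le> i" "n > 0" for n
    using that
  proof (induction n rule: inc_induct)
    case base
    then show ?case using ys by (intro exI[of _ "[]"]) simp
  next
    case (step n)
    then obtain xs where xs: "central_seq G (xs @ ys)" "generate G (set (xs @ ys)) = ?L (Suc n)"
      by auto
    show ?case using central_seq_extend[OF S step.prems xs] by (metis append.assoc)
  qed
  from this[of 1] show thesis using that ys i by auto
qed

section \<open>Images under homomorphisms and closure under conjugation\<close>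

lemma word_le_hom:
  assumes "word_le G S k t" "\<phi> \<in> hom G G" "S \<subseteq> carrier G"
    "\<And>s. s \<in> S \<Longrightarrow> word_le G S n (\<phi> s)"
  shows "word_le G S (n * k) (\<phi> t)"
proof -
  interpret \<phi>: group_hom G G \<phi>
    using assms(2) by (simp add: group_hom_def group_hom_axioms_def is_group)
  show ?thesis using assms(1)
  proof (induction rule: word_le_induct)
    case (one k)
    then show ?case by (simp add: word_le_one)
  next
    case (pos x k g)
    then have "x \<in> carrier G" "g \<in> carrier G" using assms(3) word_le_closed by blast+
    then show ?case using word_le_mult[OF assms(4)[OF pos(1)] assms(3) pos.IH] by simp
  next
    case (neg x k g)
    then have "x \<in> carrier G" "g \<in> carrier G" using assms(3) word_le_closed by blast+
    then show ?case
      using word_le_mult[OF word_le_inv[OF assms(4)[OF neg(1)] assms(3)] assms(3) neg.IH] by simp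
  qed
qed

text \<open>Adding iterated commutators with \<open>g\<close> and its inverse, which vanish after \<open>k\<close> steps, closes
  \<open>A\<close> under conjugation by \<open>g\<close>; the last clause keeps the result inside the normal closure.\<close>

lemma conj_closure:
  assumes "lower_central G (j + k) = {\<one>}" "j > 0" "finite A" "A \<subseteq> lower_central G j"
    and "S \<subseteq> carrier G" "\<And>a. a \<in> A \<Longrightarrow> word_le G S L a" "word_le G S L g"
  shows "\<exists>Z. finite Z \<and> card Z \<le> 3 ^ k * card A \<and> A \<subseteq> Z \<and> Z \<subseteq> carrier G \<and>
    (\<forall>z\<in>Z. word_le G S (4 ^ k * L) z \<and>
      g \<otimes> z \<otimes> inv g \<in> generate G Z \<and> inv g \<otimes> z \<otimes> g \<in> generate G Z) \<and>
    (\<forall>K. subgroup K G \<longrightarrow> A \<subseteq> K \<longrightarrow>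
      (\<forall>h\<in>K. g \<otimes> h \<otimes> inv g \<in> K \<and> inv g \<otimes> h \<otimes> g \<in> K) \<longrightarrow> Z \<subseteq> K)"
  using assms
proof (induction k arbitrary: j A L)
  case 0
  then have "g \<in> carrier G" by (auto intro: word_le_closed)
  then have "g \<otimes> a \<otimes> inv g \<in> generate G A \<and> inv g \<otimes> a \<otimes> g \<in> generate G A" if "a \<in> A" for a
  proof -
    have "a = \<one>" using 0 that by auto
    then show ?thesis using \<open>g \<in> carrier G\<close> by (simp add: generate.one)
  qed
  moreover have "A \<subseteq> carrier G" using 0 by auto
  ultimately show ?case using 0 by (intro exI[of _ A]) auto
next
  case (Suc k)
  have g: "g \<in> carrier G" using Suc.prems word_le_closed by blast
  have A: "A \<subseteq> carrier G" using Suc.prems(4) lower_central_carrier[OF Suc.prems(2)] by blast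
  \<comment> \<open>These commutators lie one term deeper, and g a g^-1 = [g, a] a shows that they
    are what is missing for conjugating A.\<close>
  define B where "B = comm G g ` A \<union> comm G (inv g) ` A"
  \<comment> \<open>The induction hypothesis uses one length bound for g and for the set, so the
    bound of g is relaxed to that of the commutators.\<close>
  have gL: "word_le G S (4 * L) g" by (rule word_le_mono[OF Suc.prems(7)]) simp
  have B1: "finite B" "B \<subseteq> lower_central G (Suc j)"
    using Suc.prems(3,4) comm_mem_lower_central[OF Suc.prems(2)] g by (auto simp: B_def)
  have B2: "word_le G S (4 * L) b" if "b \<in> B" for b
    using that Suc.prems(5-7) by (auto simp: B_def intro!: word_le_comm word_le_inv)
  have "card B \<le> card A + card A"
    unfolding B_def
    by (intro order_trans[OF card_Un_le] add_mono card_image_le Suc.prems)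
  then have cardB: "card B \<le> 2 * card A" by simp
  have "lower_central G (Suc j + k) = {\<one>}" using Suc.prems(1) by simp
  from Suc.IH[OF this _ B1 Suc.prems(5) B2 gL] obtain Z where
    Z: "finite Z" "card Z \<le> 3 ^ k * card B" "B \<subseteq> Z" "Z \<subseteq> carrier G"
      "\<And>z. z \<in> Z \<Longrightarrow> word_le G S (4 ^ k * (4 * L)) z"
    and Zc: "\<And>z. z \<in> Z \<Longrightarrow> g \<otimes> z \<otimes> inv g \<in> generate G Z"
      "\<And>z. z \<in> Z \<Longrightarrow> inv g \<otimes> z \<otimes> g \<in> generate G Z"
    and Zmin: "\<And>K. \<lbrakk>subgroup K G; B \<subseteq> K;
      \<And>h. h \<in> K \<Longrightarrow> g \<otimes> h \<otimes> inv g \<in> K \<and> inv g \<otimes> h \<otimes> g \<in> K\<rbrakk> \<Longrightarrow> Z \<subseteq> K"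
    by auto
  let ?Z = "A \<union> Z"
  have c: "?Z \<subseteq> carrier G" using A Z by blast
  have sub: "subgroup (generate G ?Z) G" using c by (rule generate_is_subgroup)
  have le: "generate G Z \<subseteq> generate G ?Z" by (rule mono_generate) simp
  have conjA: "g \<otimes> a \<otimes> inv g \<in> generate G ?Z" "inv g \<otimes> a \<otimes> g \<in> generate G ?Z" if "a \<in> A" for a
  proof -
    have a: "a \<in> carrier G" "a \<in> generate G ?Z" using that A by (auto intro: generate.incl)
    have "comm G g a \<in> generate G ?Z" "comm G (inv g) a \<in> generate G ?Z"
      using that Z(3) by (auto intro!: generate.incl simp: B_def)
    then have "comm G g a \<otimes> a \<in> generate G ?Z" "comm G (inv g) a \<otimes> a \<in> generate G ?Z"
      using subgroup.m_closed[OF sub] a by blast+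
    moreover have "comm G g a \<otimes> a = g \<otimes> a \<otimes> inv g" "comm G (inv g) a \<otimes> a = inv g \<otimes> a \<otimes> g"
      using a g by (simp_all add: comm_def m_assoc)
    ultimately show "g \<otimes> a \<otimes> inv g \<in> generate G ?Z" "inv g \<otimes> a \<otimes> g \<in> generate G ?Z"
      by (simp_all only:)
  qed
  \<comment> \<open>The base 3 arises as 1 + 2: A itself and twice as many commutators.\<close>
  have "card ?Z \<le> card A + 3 ^ k * (2 * card A)"
    using card_Un_le[of A Z] Z(2) mult_left_mono[OF cardB, of "3 ^ k"] by linarith
  also have "\<dots> \<le> 3 ^ k * card A + 3 ^ k * (2 * card A)" by simp
  also have "\<dots> = 3 ^ Suc k * card A" by simp
  finally have card: "card ?Z \<le> 3 ^ Suc k * card A" .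
  have len: "word_le G S (4 ^ Suc k * L) z" if "z \<in> ?Z" for z
  proof (cases "z \<in> Z")
    case True
    then show ?thesis using Z(5) by (simp add: mult.assoc mult.left_commute)
  next
    case False
    then have "word_le G S L z" using that Suc.prems(6) by blast
    moreover have "L \<le> 4 ^ Suc k * L" using mult_right_mono[of 1 "4 ^ Suc k" L] by simp
    ultimately show ?thesis by (rule word_le_mono)
  qed
  have min: "?Z \<subseteq> K" if K: "subgroup K G" "A \<subseteq> K"
    "\<forall>h\<in>K. g \<otimes> h \<otimes> inv g \<in> K \<and> inv g \<otimes> h \<otimes> g \<in> K" for K
  proof -
    have "comm G g a \<in> K" "comm G (inv g) a \<in> K" if "a \<in> A" for a
    proof -
      have a: "a \<in> K" using that K(2) by blast
      have "inv a \<in> K" by (rule subgroup.m_inv_closed[OF K(1) a])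
      then have "(g \<otimes> a \<otimes> inv g) \<otimes> inv a \<in> K" "(inv g \<otimes> a \<otimes> g) \<otimes> inv a \<in> K"
        using K(3) a by (simp_all add: subgroup.m_closed[OF K(1)])
      then show "comm G g a \<in> K" "comm G (inv g) a \<in> K"
        using g by (simp_all add: comm_def)
    qed
    then have "B \<subseteq> K" by (auto simp: B_def)
    then have "Z \<subseteq> K" using K by (intro Zmin) auto
    then show ?thesis using K(2) by blast
  qed
  have conj: "g \<otimes> z \<otimes> inv g \<in> generate G ?Z \<and> inv g \<otimes> z \<otimes> g \<in> generate G ?Z" if "z \<in> ?Z" for z
    using that conjA Zc le by blast
  show ?case
    using Suc.prems(3) Z(1) card c len conj min by (intro exI[of _ ?Z] conjI) auto
qed

lemma conj_int_pow_closed: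
  assumes "subgroup P G" "g \<in> carrier G" "p \<in> P"
    and conj: "\<And>p. p \<in> P \<Longrightarrow> g \<otimes> p \<otimes> inv g \<in> P \<and> inv g \<otimes> p \<otimes> g \<in> P"
  shows "g [^] (t::int) \<otimes> p \<otimes> inv (g [^] t) \<in> P"
proof -
  have pc: "q \<in> carrier G" if "q \<in> P" for q using assms(1) that by (rule subgroup.mem_carrier)
  have nat: "h [^] n \<otimes> p \<otimes> inv (h [^] n) \<in> P"
    if h: "h \<in> carrier G" "\<And>p. p \<in> P \<Longrightarrow> h \<otimes> p \<otimes> inv h \<in> P" for h and n :: nat
    using assms(3)
  proof (induction n arbitrary: p)
    case 0
    then show ?case using pc by simp
  next
    case (Suc n)
    have "h [^] n \<otimes> (h \<otimes> p \<otimes> inv h) \<otimes> inv (h [^] n) \<in> P" using Suc h by blast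
    then show ?case using h(1) pc[OF Suc.prems] by (simp add: m_assoc inv_mult_group)
  qed
  show ?thesis
  proof (cases t rule: int_cases2)
    case (nonneg n)
    then show ?thesis using nat[of g n] assms(2) conj by (simp add: int_pow_int)
  next
    case (nonpos n)
    then show ?thesis using nat[of "inv g" n] assms(2) conj
      by (simp add: int_pow_int int_pow_neg nat_pow_inv)
  qed
qed

end

section \<open>The twisted map into one cyclic central factor\<close>

text \<open>\<open>twisted_centralizer\<close> with an arbitrary M in place of a lower central term,
  as required for the intermediate terms of the refined series.\<close>

definition twisted :: "('a, 'b) monoid_scheme \<Rightarrow> ('a \<Rightarrow> 'a) \<Rightarrow> 'a set \<Rightarrow> 'a set" where
  "twisted G \<phi> M = {x \<in> carrier G. x \<otimes>\<^bsub>G\<^esub> inv\<^bsub>G\<^esub> (\<phi> x) \<in> M}"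

locale twisted_step = group G for G :: "('a, 'b) monoid_scheme" (structure) +
  fixes \<phi> :: "'a \<Rightarrow> 'a" and M :: "'a set" and x :: 'a
  assumes hom: "\<phi> \<in> hom G G" and normal_M: "M \<lhd> G" and x: "x \<in> carrier G"
    and central: "\<And>g. g \<in> carrier G \<Longrightarrow> comm G g x \<in> M"
begin

sublocale \<phi>: group_hom G G \<phi>
  using hom by (simp add: group_hom_def group_hom_axioms_def is_group)

text \<open>The class of \<open>h \<phi>(h)\<^sup>-\<^sup>1\<close> in the cyclic group \<open>\<langle>x\<rangle>M/M\<close> is that of \<open>x\<^sup>a\<close>; the exponent
  \<open>a\<close> is determined only modulo the order of \<open>x\<close> modulo \<open>M\<close>.\<close>

definition twist_exp :: "'a \<Rightarrow> int \<Rightarrow> bool" where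
  "twist_exp h a \<longleftrightarrow> h \<in> carrier G \<and> (\<exists>w\<in>M. h \<otimes> inv (\<phi> h) = x [^] a \<otimes> w)"

lemma sub_M: "subgroup M G"
  using normal_M by (rule normal_imp_subgroup)

lemma M_carrier: "w \<in> M \<Longrightarrow> w \<in> carrier G"
  using sub_M by (rule subgroup.mem_carrier)

lemma twist_exp_carrier: "twist_exp h a \<Longrightarrow> h \<in> carrier G"
  by (simp add: twist_exp_def)

text \<open>Both x and the elements of M are central modulo M, hence so is everything they
  generate.\<close>

lemma comm_twist_mem:
  assumes "g \<in> carrier G" "w \<in> M"
  shows "comm G g (x [^] (a::int) \<otimes> w) \<in> M"
proof (rule comm_mem_generate[OF normal_M assms(1), of "insert x M"])
  have "x [^] a \<in> generate G (insert x M)" "w \<in> generate G (insert x M)"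
    using x M_carrier assms
      subgroup_int_pow_closed[OF generate_is_subgroup[of "insert x M"], of x a]
    by (auto intro: generate.incl)
  then show "x [^] a \<otimes> w \<in> generate G (insert x M)" by (rule generate.eng)
qed (use x M_carrier central assms comm_mem_normal[OF normal_M] in auto)

text \<open>The identity hk phi(hk)^-1 = h (k phi(k)^-1) h^-1 (h phi(h)^-1) holds, and conjugation
  by h does not change the class of k phi(k)^-1, which is central modulo M.\<close>

lemma twist_exp_mult:
  assumes "twist_exp h a" "twist_exp k b"
  shows "twist_exp (h \<otimes> k) (a + b)"
proof -
  obtain w v where h: "h \<in> carrier G" "w \<in> M" "h \<otimes> inv (\<phi> h) = x [^] a \<otimes> w"
    and k: "k \<in> carrier G" "v \<in> M" "k \<otimes> inv (\<phi> k) = x [^] b \<otimes> v"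
    using assms by (auto simp: twist_exp_def)
  define c where "c = comm G h (x [^] b \<otimes> v)"
  have c: "c \<in> M" unfolding c_def by (rule comm_twist_mem[OF h(1) k(2)])
  \<comment> \<open>The primed elements are conjugates that move the M-parts to the right of the
    powers of x.\<close>
  obtain c' where c': "c' \<in> M" "c \<otimes> x [^] (b + a) = x [^] (b + a) \<otimes> c'"
    using normal_swap[OF normal_M c, of "x [^] (b + a)"] x by auto
  obtain v' where v': "v' \<in> M" "v \<otimes> x [^] a = x [^] a \<otimes> v'"
    using normal_swap[OF normal_M k(2), of "x [^] a"] x by auto
  note cc = x h(1) k(1) M_carrier[OF h(2)] M_carrier[OF k(2)] M_carrier[OF c]
    M_carrier[OF c'(1)] M_carrier[OF v'(1)]
  have "h \<otimes> k \<otimes> inv (\<phi> (h \<otimes> k)) = (h \<otimes> (k \<otimes> inv (\<phi> k)) \<otimes> inv h) \<otimes> (h \<otimes> inv (\<phi> h))"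
    using cc by (simp add: m_assoc inv_mult_group)
  also have "\<dots> = c \<otimes> (x [^] b \<otimes> v) \<otimes> (x [^] a \<otimes> w)"
    unfolding h(3) k(3) c_def using cc by (simp add: comm_def m_assoc)
  also have "\<dots> = c \<otimes> x [^] b \<otimes> (v \<otimes> x [^] a) \<otimes> w"
    using cc by (simp add: m_assoc)
  also have "\<dots> = c \<otimes> x [^] (b + a) \<otimes> (v' \<otimes> w)"
    unfolding v'(2) using cc by (simp add: m_assoc int_pow_mult)
  also have "\<dots> = x [^] (a + b) \<otimes> (c' \<otimes> (v' \<otimes> w))"
    unfolding c'(2) using cc by (simp add: m_assoc add.commute)
  finally show ?thesis
    unfolding twist_exp_def
    using cc subgroup.m_closed[OF sub_M c'(1) subgroup.m_closed[OF sub_M v'(1) h(2)]] by blast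
qed

text \<open>Applied with exponent 0 and with the order q of x modulo M.\<close>

lemma twist_exp_one: "x [^] a \<in> M \<Longrightarrow> twist_exp \<one> a"
  unfolding twist_exp_def
  using subgroup.m_inv_closed[OF sub_M] x by (auto intro!: bexI[of _ "inv (x [^] a)"])

lemma twist_exp_inv:
  assumes "twist_exp h a" shows "twist_exp (inv h) (- a)"
proof -
  obtain w where h: "h \<in> carrier G" "w \<in> M" "h \<otimes> inv (\<phi> h) = x [^] a \<otimes> w"
    using assms by (auto simp: twist_exp_def)
  obtain v where v: "v \<in> M" "inv w \<otimes> x [^] (- a) = x [^] (- a) \<otimes> v"
    using normal_swap[OF normal_M subgroup.m_inv_closed[OF sub_M h(2)], of "x [^] (- a)"] x by auto
  define c where "c = comm G (inv h) (x [^] (- a) \<otimes> v)"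
  have c: "c \<in> M" unfolding c_def using comm_twist_mem h(1) v(1) by simp
  obtain c' where c': "c' \<in> M" "c \<otimes> x [^] (- a) = x [^] (- a) \<otimes> c'"
    using normal_swap[OF normal_M c, of "x [^] (- a)"] x by auto
  note cc = x h(1) M_carrier[OF h(2)] M_carrier[OF v(1)] M_carrier[OF c] M_carrier[OF c'(1)]
  have "inv h \<otimes> inv (\<phi> (inv h)) = inv h \<otimes> inv (h \<otimes> inv (\<phi> h)) \<otimes> h"
    using cc by (simp add: m_assoc inv_mult_group)
  also have "\<dots> = inv h \<otimes> (inv w \<otimes> x [^] (- a)) \<otimes> h"
    unfolding h(3) using cc by (simp add: m_assoc inv_mult_group int_pow_neg)
  also have "\<dots> = c \<otimes> x [^] (- a) \<otimes> v"
    unfolding v(2) c_def using cc by (simp add: comm_def m_assoc)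
  also have "\<dots> = x [^] (- a) \<otimes> (c' \<otimes> v)"
    unfolding c'(2) using cc by (simp add: m_assoc)
  finally show ?thesis
    unfolding twist_exp_def
    using cc subgroup.m_closed[OF sub_M c'(1) v(1)] by (meson inv_closed)
qed

lemma twist_exp_int_pow:
  assumes "twist_exp h a" shows "twist_exp (h [^] (t::int)) (t * a)"
proof -
  have one: "twist_exp \<one> 0" using subgroup.one_closed[OF sub_M] by (intro twist_exp_one) simp
  have nat: "twist_exp (h [^] (n::nat)) (int n * a)" for n
  proof (induction n)
    case 0
    then show ?case using one by simp
  next
    case (Suc n)
    have "int (Suc n) * a = int n * a + a" by (simp add: algebra_simps)
    then show ?case using twist_exp_mult[OF Suc assms] by (simp only: nat_pow_Suc)
  qed
  show ?thesis
  proof (cases t rule: int_cases2)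
    case (nonneg n)
    then show ?thesis using nat[of n] by (simp add: int_pow_int)
  next
    case (nonpos n)
    then show ?thesis using twist_exp_inv[OF nat[of n]] twist_exp_carrier[OF assms]
      by (simp add: int_pow_int int_pow_neg)
  qed
qed

lemma twist_exp_zero_iff: "twist_exp h 0 \<longleftrightarrow> h \<in> twisted G \<phi> M"
  unfolding twist_exp_def twisted_def using M_carrier by auto

lemma twist_exp_unique:
  assumes "twist_exp h a" "twist_exp h b" shows "x [^] (a - b) \<in> M"
proof -
  have h: "h \<in> carrier G" using assms(1) by (rule twist_exp_carrier)
  have "twist_exp \<one> (a - b)"
    using twist_exp_mult[OF assms(1) twist_exp_inv[OF assms(2)]] h by simp
  then obtain w where w: "w \<in> M" "\<one> = x [^] (a - b) \<otimes> w" by (auto simp: twist_exp_def)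
  then have "x [^] (a - b) = inv w" using x M_carrier by (metis inv_equality int_pow_closed)
  then show ?thesis using w(1) subgroup.m_inv_closed[OF sub_M] by simp
qed

text \<open>One Bezout step per pair: its coefficients are at most B because the running gcd is, so
  the length grows by a factor of at most \<open>2 * B\<close>. The last clause makes g trivial when
  all exponents vanish, so that no power of g is left over in the kernel computation.\<close>

lemma twist_exp_gcd:
  assumes "finite P" "S \<subseteq> carrier G" "B \<ge> 1"
    and "\<And>h a. (h, a) \<in> P \<Longrightarrow> twist_exp h a \<and> \<bar>a\<bar> \<le> int B \<and> word_le G S L h"
  shows "\<exists>g d. g \<in> generate G (fst ` P) \<and> twist_exp g d \<and> \<bar>d\<bar> \<le> int B \<and>
    word_le G S ((2 * B) ^ card P * L) g \<and> (\<forall>(h, a) \<in> P. d dvd a) \<and> (d = 0 \<longrightarrow> g = \<one>)"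
  using assms(1,4)
proof (induction P rule: finite_induct)
  case empty
  then show ?case using subgroup.one_closed[OF sub_M]
    by (intro exI[of _ \<one>] exI[of _ 0]) (auto intro: generate.one twist_exp_one word_le_one)
next
  case (insert z P)
  obtain h a where z: "z = (h, a)" by fastforce
  obtain g d where g: "g \<in> generate G (fst ` P)" "twist_exp g d" "\<bar>d\<bar> \<le> int B"
    "word_le G S ((2 * B) ^ card P * L) g" "\<And>h a. (h, a) \<in> P \<Longrightarrow> d dvd a" "d = 0 \<longrightarrow> g = \<one>"
    using insert.IH insert.prems by fastforce
  have h: "twist_exp h a" "\<bar>a\<bar> \<le> int B" "word_le G S L h" using insert.prems z by auto
  let ?H = "generate G (fst ` insert z P)"
  show ?case
  \<comment> \<open>With both exponents zero the identity is taken directly, as the last clause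
    demands.\<close>
  proof (cases "a = 0 \<and> d = 0")
    case True
    then show ?thesis
      using g subgroup.one_closed[OF sub_M] z
      by (intro exI[of _ \<one>] exI[of _ 0])
        (auto intro: generate.one twist_exp_one word_le_one)
  next
    case False
    obtain u v where uv: "u * a + v * d = gcd a d" "\<bar>u\<bar> \<le> int B" "\<bar>v\<bar> \<le> int B"
      using bezout_bounded[OF h(2) g(3)] assms(3) by auto
    define k where "k = h [^] u \<otimes> g [^] v"
    have car: "fst ` insert z P \<subseteq> carrier G" using insert.prems twist_exp_carrier by fastforce
    have H: "subgroup ?H G" using car by (rule generate_is_subgroup)
    have "generate G (fst ` P) \<subseteq> ?H" by (intro mono_generate) auto
    then have "h \<in> ?H" "g \<in> ?H" using g z by (auto intro: generate.incl)
    then have 1: "k \<in> ?H" unfolding k_def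
      using subgroup_int_pow_closed[OF H] subgroup.m_closed[OF H] by blast
    have 2: "twist_exp k (gcd a d)"
      unfolding k_def uv(1)[symmetric] by (intro twist_exp_mult twist_exp_int_pow h g)
    have "gcd a d \<le> max \<bar>a\<bar> \<bar>d\<bar>"
    proof (cases "a = 0")
      case False
      then have "gcd a d \<le> \<bar>a\<bar>" by (simp add: zdvd_imp_le[of _ "\<bar>a\<bar>"])
      then show ?thesis by simp
    qed simp
    then have 3: "\<bar>gcd a d\<bar> \<le> int B" using h(2) g(3) by simp
    have "word_le G S (B * L + B * ((2 * B) ^ card P * L)) k" unfolding k_def
      by (intro word_le_mult word_le_int_pow_le h g uv assms)
    moreover have "B * L + B * ((2 * B) ^ card P * L) \<le> (2 * B) ^ card (insert z P) * L"
    proof -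
      have "1 \<le> (2 * B) ^ card P" using assms(3) by simp
      then have "B * L \<le> B * ((2 * B) ^ card P * L)"
        using mult_right_mono[of 1 "(2 * B) ^ card P" L] by simp
      then show ?thesis using insert.hyps by (simp add: mult.assoc)
    qed
    ultimately have 4: "word_le G S ((2 * B) ^ card (insert z P) * L) k" by (rule word_le_mono)
    have 5: "\<forall>(h', a') \<in> insert z P. gcd a d dvd a'"
      using g(5) z by (auto intro: dvd_trans[OF gcd_dvd2])
    show ?thesis using 1 2 3 4 5 False
      by (intro exI[of _ k] exI[of _ "gcd a d"] conjI) (auto simp: gcd_eq_0_iff)
  qed
qed

text \<open>The subgroup generated by Z is closed under conjugation by g and contains all h
  g^(-a/d), so every element of the group generated by T is p g^t with p in it. For an element of
  the kernel q divides t d, so g^t is a power of g^(-q/d), the corrected form of the pair of the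
  identity with q; if d = 0 then g is trivial.\<close>

lemma generate_twisted_kernel:
  assumes c: "lower_central G (Suc c) = {\<one>}"
    and q: "\<And>a::int. x [^] a \<in> M \<longleftrightarrow> int q dvd a"
    and S: "S \<subseteq> carrier G"
    and T: "finite T" "card T \<le> m" "\<And>h. h \<in> T \<Longrightarrow> word_le G S L h"
    and B: "B \<ge> 1" "q \<le> B"
    and exp: "\<And>h. h \<in> T \<Longrightarrow> \<exists>a. twist_exp h a \<and> \<bar>a\<bar> \<le> int B"
    and sup: "twisted G \<phi> M \<subseteq> generate G T"
  shows "\<exists>Z. finite Z \<and> card Z \<le> 3 ^ c * Suc m \<and> generate G Z = twisted G \<phi> M \<and>
    (\<forall>z\<in>Z. word_le G S (4 ^ c * (L + B * ((2 * B) ^ Suc m * L))) z)"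
proof -
  obtain \<alpha> where \<alpha>: "\<And>h. h \<in> T \<Longrightarrow> twist_exp h (\<alpha> h)" "\<And>h. h \<in> T \<Longrightarrow> \<bar>\<alpha> h\<bar> \<le> int B"
    using exp by metis
  \<comment> \<open>The extra pair puts the order \<open>q\<close> of \<open>x\<close> modulo \<open>M\<close> into the gcd; pairs are used because
    \<open>\<one>\<close> may also occur in \<open>T\<close> with another exponent. If \<open>d = 0\<close> below, then \<open>a div d = 0\<close>.\<close>
  define P where "P = insert (\<one>, int q) ((\<lambda>h. (h, \<alpha> h)) ` T)"
  have P: "finite P" using T by (simp add: P_def)
  have cardP: "card P \<le> Suc m"
  proof -
    have "card ((\<lambda>h. (h, \<alpha> h)) ` T) \<le> m" using card_image_le[OF T(1)] T(2) order_trans by blast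
    then show ?thesis unfolding P_def using T(1) by (simp add: card_insert_if)
  qed
  have one_q: "twist_exp \<one> (int q)" using q by (intro twist_exp_one) simp
  have Pprop: "twist_exp h a \<and> \<bar>a\<bar> \<le> int B \<and> word_le G S L h" if "(h, a) \<in> P" for h a
    using that \<alpha> T(3) B one_q word_le_one by (auto simp: P_def)
  obtain g d where g: "g \<in> generate G (fst ` P)" "twist_exp g d" "\<bar>d\<bar> \<le> int B"
    "word_le G S ((2 * B) ^ card P * L) g" "\<And>h a. (h, a) \<in> P \<Longrightarrow> d dvd a" "d = 0 \<longrightarrow> g = \<one>"
    using twist_exp_gcd[OF P S B(1) Pprop] by fast
  have gc: "g \<in> carrier G" using g(2) by (rule twist_exp_carrier)
  have Tc: "T \<subseteq> carrier G" using \<alpha>(1) twist_exp_carrier by blast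
  \<comment> \<open>Length of h plus that of at most B copies of g or its inverse.\<close>
  let ?L = "L + B * ((2 * B) ^ Suc m * L)"
  have "(2 * B) ^ card P * L \<le> (2 * B) ^ Suc m * L"
    using cardP B(1) by (intro mult_right_mono power_increasing) auto
  then have gl: "word_le G S ((2 * B) ^ Suc m * L) g" by (rule word_le_mono[OF g(4)])
  define f where "f = (\<lambda>(h, a). h \<otimes> g [^] (- (a div d)))"
  define A where "A = f ` P"
  have A: "finite A" "card A \<le> Suc m"
    using P cardP card_image_le[OF P, of f] by (auto simp: A_def)
  have divd: "\<bar>a div d\<bar> \<le> int B" if "(h, a) \<in> P" for h a
  proof -
    have "\<bar>a div d\<bar> \<le> \<bar>a\<bar>"
    proof (cases "d = 0")
      case False
      have "a = d * (a div d)" using g(5)[OF that] by simp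
      then have "\<bar>a\<bar> = \<bar>d\<bar> * \<bar>a div d\<bar>" by (metis abs_mult)
      moreover have "1 * \<bar>a div d\<bar> \<le> \<bar>d\<bar> * \<bar>a div d\<bar>" using False by (intro mult_right_mono) auto
      ultimately show ?thesis by simp
    qed simp
    then show ?thesis using Pprop[OF that] by simp
  qed
  have Aexp: "twist_exp y 0 \<and> word_le G S ?L y" if y: "y \<in> A" for y
  proof -
    obtain h a where ha: "(h, a) \<in> P" "y = h \<otimes> g [^] (- (a div d))"
      using y by (auto simp: A_def f_def)
    have "twist_exp y (a + - (a div d) * d)"
      unfolding ha(2) using Pprop[OF ha(1)] by (intro twist_exp_mult twist_exp_int_pow g) simp
    moreover have "word_le G S ?L y"
      unfolding ha(2) using Pprop[OF ha(1)] divd[OF ha(1)]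
      by (intro word_le_mult word_le_int_pow_le gl S) auto
    ultimately show ?thesis using g(5)[OF ha(1)] by simp
  qed
  have g_len: "word_le G S ?L g"
  proof (rule word_le_mono[OF gl])
    have "1 * ((2 * B) ^ Suc m * L) \<le> B * ((2 * B) ^ Suc m * L)"
      using B(1) by (intro mult_right_mono) auto
    then show "(2 * B) ^ Suc m * L \<le> ?L" by linarith
  qed
  \<comment> \<open>A starts in the first term, so c rounds of commutators reach the trivial
    one.\<close>
  have "lower_central G (1 + c) = {\<one>}" using c by simp
  moreover have "A \<subseteq> lower_central G 1" using Aexp twist_exp_carrier by auto
  ultimately obtain Z where Z: "finite Z" "card Z \<le> 3 ^ c * card A" "A \<subseteq> Z" "Z \<subseteq> carrier G"
      "\<And>z. z \<in> Z \<Longrightarrow> word_le G S (4 ^ c * ?L) z"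
    and Zc: "\<And>z. z \<in> Z \<Longrightarrow> g \<otimes> z \<otimes> inv g \<in> generate G Z"
      "\<And>z. z \<in> Z \<Longrightarrow> inv g \<otimes> z \<otimes> g \<in> generate G Z"
    and Zmin: "\<And>K. \<lbrakk>subgroup K G; A \<subseteq> K;
      \<And>h. h \<in> K \<Longrightarrow> g \<otimes> h \<otimes> inv g \<in> K \<and> inv g \<otimes> h \<otimes> g \<in> K\<rbrakk> \<Longrightarrow> Z \<subseteq> K"
    using conj_closure[of 1 c A S ?L g] A(1) S Aexp g_len by auto
  let ?Q = "generate G Z" and ?K = "twisted G \<phi> M"
  have Q: "subgroup ?Q G" by (rule generate_is_subgroup[OF Z(4)])
  have K: "subgroup ?K G"
    using twist_exp_mult[of _ 0 _ 0] twist_exp_inv[of _ 0] twist_exp_one[of 0]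
      subgroup.one_closed[OF sub_M] twist_exp_carrier
    by (intro subgroupI) (auto simp: twist_exp_zero_iff[symmetric])
  \<comment> \<open>The exponents add up to d + 0 - d, or -d + 0 + d, so conjugation preserves the
    kernel and the minimality of Z applies to it.\<close>
  have "g \<otimes> h \<otimes> inv g \<in> ?K \<and> inv g \<otimes> h \<otimes> g \<in> ?K" if h: "h \<in> ?K" for h
    using twist_exp_mult[OF twist_exp_mult[OF g(2), of h 0] twist_exp_inv[OF g(2)]]
      twist_exp_mult[OF twist_exp_mult[OF twist_exp_inv[OF g(2)], of h 0] g(2)] h
    by (simp add: twist_exp_zero_iff[symmetric])
  then have "Z \<subseteq> ?K" using Aexp by (intro Zmin K) (auto simp: twist_exp_zero_iff)
  then have "?Q \<subseteq> ?K" by (intro generate_subgroup_incl K)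
  moreover have "?K \<subseteq> ?Q"
  proof
    have AQ: "A \<subseteq> ?Q" using Z(3) by (auto intro: generate.incl)
    have Qc: "p \<in> carrier G" if "p \<in> ?Q" for p using Q that by (rule subgroup.mem_carrier)
    have "g \<otimes> p \<otimes> inv g \<in> ?Q \<and> inv g \<otimes> p \<otimes> g \<in> ?Q" if "p \<in> ?Q" for p
      using conj_generate[OF that Z(4) gc Q Zc(1)]
        conj_generate[OF that Z(4) inv_closed[OF gc] Q] Zc(2) gc by simp
    then have conj: "g [^] t \<otimes> p \<otimes> inv (g [^] t) \<in> ?Q" if "p \<in> ?Q" for p and t :: int
      using conj_int_pow_closed[OF Q gc that] by blast
    have decomp: "\<exists>p\<in>?Q. \<exists>t::int. h = p \<otimes> g [^] t" if "h \<in> generate G T" for h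
      using that
    proof (induction rule: generate.induct)
      case one
      then show ?case using generate.one[of G Z] by (intro bexI[of _ \<one>] exI[of _ 0]) auto
    next
      case (incl h)
      have "h \<otimes> g [^] (- (\<alpha> h div d)) \<in> ?Q"
        using AQ incl by (auto simp: A_def f_def P_def)
      moreover have "h = h \<otimes> g [^] (- (\<alpha> h div d)) \<otimes> g [^] (\<alpha> h div d)"
        using incl Tc gc by (auto simp: int_pow_neg m_assoc)
      ultimately show ?case by blast
    next
      case (inv h)
      have h: "h \<in> carrier G" using inv Tc by blast
      let ?e = "\<alpha> h div d"
      define p where "p = h \<otimes> g [^] (- ?e)"
      have p: "p \<in> ?Q" "p \<in> carrier G"
        using AQ inv Qc by (auto simp: A_def f_def P_def p_def)
      \<comment> \<open>From h = p g^e one gets h^-1 = (g^-e p^-1 g^e) g^-e, whose bracket stays in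
        the subgroup by closure under conjugation.\<close>
      have "g [^] (- ?e) \<otimes> inv p \<otimes> inv (g [^] (- ?e)) \<in> ?Q"
        using conj subgroup.m_inv_closed[OF Q p(1)] by blast
      moreover have "inv h = g [^] (- ?e) \<otimes> inv p \<otimes> inv (g [^] (- ?e)) \<otimes> g [^] (- ?e)"
        unfolding p_def using h gc by (simp add: int_pow_neg m_assoc inv_mult_group)
      ultimately show ?case by blast
    next
      case (eng h1 h2)
      then obtain p1 p2 and t1 t2 :: int where p: "p1 \<in> ?Q" "h1 = p1 \<otimes> g [^] t1"
        "p2 \<in> ?Q" "h2 = p2 \<otimes> g [^] t2" by blast
      have "p1 \<otimes> (g [^] t1 \<otimes> p2 \<otimes> inv (g [^] t1)) \<in> ?Q"
        using subgroup.m_closed[OF Q p(1) conj[OF p(3)]] .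
      moreover have "h1 \<otimes> h2 = p1 \<otimes> (g [^] t1 \<otimes> p2 \<otimes> inv (g [^] t1)) \<otimes> g [^] (t1 + t2)"
        unfolding p(2,4) using Qc[OF p(1)] Qc[OF p(3)] gc by (simp add: int_pow_mult m_assoc)
      ultimately show ?case by blast
    qed
    fix k assume k: "k \<in> ?K"
    then obtain p and t :: int where p: "p \<in> ?Q" "k = p \<otimes> g [^] t" using decomp sup by blast
    have "twist_exp p 0" using \<open>?Q \<subseteq> ?K\<close> p(1) by (auto simp: twist_exp_zero_iff)
    then have "twist_exp k (0 + t * d)"
      unfolding p(2) by (intro twist_exp_mult twist_exp_int_pow g)
    moreover have "twist_exp k 0" using k by (simp add: twist_exp_zero_iff)
    ultimately have "x [^] (0 + t * d - 0) \<in> M" by (rule twist_exp_unique)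
    then have qd: "int q dvd t * d" using q[of "t * d"] by simp
    show "k \<in> ?Q"
    proof (cases "d = 0")
      case True
      then show ?thesis using p g(6) Qc by simp
    next
      case False
      let ?e = "int q div d"
      have "int q = ?e * d" using g(5)[of \<one> "int q"] by (simp add: P_def)
      then have "?e dvd t" using qd False by (metis dvd_mult_cancel_right)
      \<comment> \<open>The double sign matches the element g^(-q/d) available in A.\<close>
      then obtain r where r: "t = (- ?e) * (- r)" by (auto elim!: dvdE)
      have "\<one> \<otimes> g [^] (- ?e) \<in> ?Q" using AQ by (auto simp: A_def f_def P_def)
      then have "g [^] (- ?e) \<in> ?Q" using gc by simp
      then have "(g [^] (- ?e)) [^] (- r) \<in> ?Q" by (rule subgroup_int_pow_closed[OF Q])
      then have "g [^] t \<in> ?Q" unfolding r using gc by (simp only: int_pow_pow)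
      then show ?thesis unfolding p(2) by (rule subgroup.m_closed[OF Q p(1)])
    qed
  qed
  ultimately have "?Q = ?K" by blast
  moreover have "card Z \<le> 3 ^ c * Suc m"
    using Z(2) A(2) mult_left_mono[of "card A" "Suc m" "3 ^ c"] by linarith
  ultimately show ?thesis using Z(1,5) by blast
qed

end

section \<open>Induction along the central sequence\<close>

context group
begin

text \<open>Both m and p are fixed before phi and n, which gives the uniformity. The induction moves
  one element at a time from the suffix to the prefix, starting with the suffix that generates the
  whole group, where S itself serves.\<close>

lemma twisted_generators:
  assumes c: "lower_central G (Suc c) = {\<one>}"
    and S: "finite S" "S \<subseteq> carrier G" "generate G S = carrier G"
    and "central_seq G (xs @ ys)" "generate G (set (xs @ ys)) = carrier G"
  shows "\<exists>m p. poly_bounded p \<and> (\<forall>\<phi>\<in>hom G G. \<forall>n. (\<forall>s\<in>S. word_le G S n (\<phi> s)) \<longrightarrow>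
    (\<exists>T. finite T \<and> card T \<le> m \<and> generate G T = twisted G \<phi> (generate G (set ys)) \<and>
      (\<forall>t\<in>T. word_le G S (p n) t)))"
  using assms(5,6)
proof (induction xs arbitrary: ys rule: rev_induct)
  case Nil
  have "generate G S = twisted G \<phi> (generate G (set ys))" if "\<phi> \<in> hom G G" for \<phi>
    using Nil S(3) hom_in_carrier[OF that] by (auto simp: twisted_def)
  moreover have "word_le G S 1 t" if "t \<in> S" for t by (rule word_le_base[OF that S(2)])
  ultimately show ?case using S(1)
    by (intro exI[of _ "card S"] exI[of _ "\<lambda>_. 1"]) (auto simp: poly_bounded_const)
next
  case (snoc x xs)
  let ?M = "generate G (set ys)"
  have cs: "central_seq G (xs @ x # ys)" and gen: "generate G (set (xs @ x # ys)) = carrier G"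
    using snoc.prems by simp_all
  obtain m p where p: "poly_bounded p"
    and pT: "\<forall>\<phi>\<in>hom G G. \<forall>n. (\<forall>s\<in>S. word_le G S n (\<phi> s)) \<longrightarrow>
      (\<exists>T. finite T \<and> card T \<le> m \<and> generate G T = twisted G \<phi> (generate G (set (x # ys))) \<and>
        (\<forall>t\<in>T. word_le G S (p n) t))"
    using snoc.IH[OF cs gen] by (elim exE conjE)
  have csx: "central_seq G (x # ys)" by (rule central_seq_append[OF cs])
  have x: "x \<in> carrier G" and ysc: "set ys \<subseteq> carrier G"
    using csx central_seq_carrier by auto
  have M: "?M \<lhd> G" using csx by (intro central_seq_normal) simp
  obtain r where r: "poly_bounded r" "\<And>n g. \<lbrakk>word_le G (set (xs @ x # ys)) n g;
    g \<in> generate G (set (x # ys))\<rbrakk> \<Longrightarrow> word_le G (set (x # ys)) (r n) g"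
    using distortion_suffix[OF cs] by blast
  obtain l where l: "\<And>n g. word_le G S n g \<Longrightarrow> word_le G (set (xs @ x # ys)) (l * n) g"
    using word_le_change_generators[OF S(1) _ central_seq_carrier[OF cs]] S(2) gen by auto
  obtain e where e: "\<And>n g. word_le G (set (x # ys)) n g \<Longrightarrow>
    \<exists>a w. \<bar>a\<bar> \<le> int n \<and> word_le G (set ys) (e n) w \<and> g = x [^] (a::int) \<otimes> w"
    using collect_first[OF csx] by blast
  obtain q :: nat where q: "\<And>a::int. x [^] a \<in> ?M \<longleftrightarrow> int q dvd a"
    using exponents_multiples[OF normal_imp_subgroup[OF M] x] by blast
  \<comment> \<open>The word for h phi(h)^-1 has length \<open>p n + n * p n\<close> in S; l
    rewrites it in the sequence and r in the suffix starting with x, whose length bounds the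
    exponent of x. The summands q and 1 ensure \<open>q \<le> B n\<close> and
    \<open>B n \<ge> 1\<close>.\<close>
  define B where "B n = r (l * (p n + n * p n)) + q + 1" for n
  define P where "P n = 4 ^ c * (p n + B n * ((2 * B n) ^ Suc m * p n))" for n
  have "poly_bounded B" unfolding B_def
    by (intro poly_bounded_intros poly_bounded_compose[OF r(1)] p)
  then have P: "poly_bounded P" unfolding P_def by (intro poly_bounded_intros p)
  have "\<exists>T. finite T \<and> card T \<le> 3 ^ c * Suc m \<and> generate G T = twisted G \<phi> ?M \<and>
      (\<forall>t\<in>T. word_le G S (P n) t)"
    if \<phi>: "\<phi> \<in> hom G G" and n: "\<And>s. s \<in> S \<Longrightarrow> word_le G S n (\<phi> s)" for \<phi> n
  proof -
    interpret twisted_step G \<phi> ?M x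
      using \<phi> M x csx by (intro twisted_step.intro twisted_step_axioms.intro is_group) auto
    obtain T where T: "finite T" "card T \<le> m" "\<And>t. t \<in> T \<Longrightarrow> word_le G S (p n) t"
      "generate G T = twisted G \<phi> (generate G (set (x # ys)))"
      using pT \<phi> n by meson
    have "\<exists>a. twist_exp h a \<and> \<bar>a\<bar> \<le> int (B n)" if h: "h \<in> T" for h
    proof -
      have "h \<in> twisted G \<phi> (generate G (set (x # ys)))"
        unfolding T(4)[symmetric] using h by (rule generate.incl)
      then have u: "h \<in> carrier G" "h \<otimes> inv (\<phi> h) \<in> generate G (set (x # ys))"
        by (simp_all add: twisted_def)
      have "word_le G S (p n + n * p n) (h \<otimes> inv (\<phi> h))"
        using T(3)[OF h] by (intro word_le_mult word_le_inv word_le_hom[OF _ \<phi>] n S)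
      from e[OF r(2)[OF l[OF this] u(2)]] obtain a w where
        aw: "\<bar>a\<bar> \<le> int (r (l * (p n + n * p n)))"
          "word_le G (set ys) (e (r (l * (p n + n * p n)))) w" "h \<otimes> inv (\<phi> h) = x [^] (a::int) \<otimes> w"
        by blast
      have "twist_exp h a"
        unfolding twist_exp_def using u(1) aw(3) word_le_imp_generate[OF aw(2)] by blast
      then show ?thesis using aw(1) by (intro exI[of _ a]) (simp add: B_def)
    qed
    moreover have "twisted G \<phi> ?M \<subseteq> generate G T"
      unfolding T(4) using mono_generate[of "set ys" "set (x # ys)"] by (auto simp: twisted_def)
    ultimately show ?thesis
      unfolding P_def using generate_twisted_kernel[OF c q S(2) T(1-3), of "B n"]
      by (simp add: B_def)
  qed
  then show ?case using P by (intro exI[of _ "3 ^ c * Suc m"] exI[of _ P]) blast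
qed

section \<open>From word bounds to the norms of the statement\<close>

lemma word_length_le:
  assumes "word_le G S n g" shows "word_length G S g \<le> n"
proof -
  obtain w where w: "length w \<le> n" "snd ` set w \<subseteq> S" "word_eval G w = g"
    using assms by (auto simp: word_le_def)
  then have "word_length G S g \<le> length w" unfolding word_length_def by (intro Least_le) blast
  then show ?thesis using w(1) by simp
qed

lemma word_le_word_length:
  assumes "g \<in> generate G S" "S \<subseteq> carrier G" shows "word_le G S (word_length G S g) g"
proof -
  obtain n w where "length w \<le> n" "snd ` set w \<subseteq> S" "word_eval G w = g"
    using generate_imp_word_le[OF assms] by (auto simp: word_le_def)
  then have "\<exists>n w. length w = n \<and> snd ` set w \<subseteq> S \<and> word_eval G w = g" by blast
  from LeastI_ex[OF this] obtain v where
    "length v = word_length G S g" "snd ` set v \<subseteq> S" "word_eval G v = g"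
    unfolding word_length_def by blast
  then show ?thesis unfolding word_le_def by (intro exI[of _ v]) simp
qed

lemma subgroup_norm_le:
  assumes "finite T" "generate G T = H" "\<And>t. t \<in> T \<Longrightarrow> word_le G S n t"
  shows "subgroup_norm G S H \<le> n"
proof -
  have "T \<subseteq> H" using assms(2) generate.incl by fast
  then have "subgroup_norm G S H \<le> Max (insert 0 ((\<lambda>h. word_length G S h) ` T))"
    unfolding subgroup_norm_def using assms(1,2) by (intro Least_le) blast
  also have "\<dots> \<le> n" using assms(1,3) word_length_le by (intro Max.boundedI) auto
  finally show ?thesis .
qed

lemma word_le_aut_norm:
  assumes "finite S" "S \<subseteq> carrier G" "generate G S = carrier G" "\<phi> \<in> hom G G" "s \<in> S"
  shows "word_le G S (aut_norm G S \<phi>) (\<phi> s)"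
proof -
  have "word_length G S (\<phi> s) \<le> aut_norm G S \<phi>"
    unfolding aut_norm_def using assms by (intro Max_ge) auto
  moreover have "\<phi> s \<in> generate G S" using assms hom_in_carrier[OF assms(4)] by auto
  ultimately show ?thesis using word_le_mono[OF word_le_word_length[OF _ assms(2)]] by simp
qed

text \<open>Covers the case where the power of the norm may vanish while the polynomial bound does
  not: phi kills S, and injectivity makes S trivial.\<close>

lemma trivial_if_aut_norm_zero:
  assumes "finite S" "S \<subseteq> carrier G" "generate G S = carrier G" "\<phi> \<in> iso G G"
    "aut_norm G S \<phi> = 0"
  shows "carrier G = {\<one>}"
proof -
  have \<phi>: "\<phi> \<in> hom G G" "inj_on \<phi> (carrier G)" using assms(4) by (auto simp: iso_def bij_betw_def)
  have "s = \<one>" if s: "s \<in> S" for s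
  proof -
    have "word_le G S 0 (\<phi> s)" using word_le_aut_norm[OF assms(1-3) \<phi>(1) s] assms(5) by simp
    then have "\<phi> s = \<one>" by (simp add: word_le_def)
    also have "\<dots> = \<phi> \<one>" using hom_one[OF \<phi>(1)] is_group by simp
    finally show ?thesis using inj_onD[OF \<phi>(2)] s assms(2) by auto
  qed
  then have "generate G S \<subseteq> {\<one>}" using generate_subgroup_incl[of S "{\<one>}"] triv_subgroup by blast
  then show ?thesis using assms(3) by blast
qed

lemma twisted_centralizer_norm_bound:
  assumes S: "finite S" "S \<subseteq> carrier G" "generate G S = carrier G"
    and c: "lower_central G c = {\<one>}" and i: "i > 0"
  shows "\<exists>p. poly_bounded p \<and> (\<forall>\<phi>\<in>hom G G.
    subgroup_norm G S (twisted_centralizer G i \<phi>) \<le> p (aut_norm G S \<phi>))"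
proof -
  obtain xs ys where xy: "central_seq G (xs @ ys)" "generate G (set (xs @ ys)) = carrier G"
    "generate G (set ys) = lower_central G i"
    using central_seq_through_lower_central[OF S c i] by blast
  \<comment> \<open>The index is shifted by one because the commutator rounds are counted from the
    first term; c = 0 can occur only for the trivial group.\<close>
  have "lower_central G (Suc c) = {\<one>}"
  proof (cases "c = 0")
    case True
    then show ?thesis using c by simp
  next
    case False
    then show ?thesis
      using lower_central_decreasing[of c] c
        subgroup.one_closed[OF normal_imp_subgroup[OF lower_central_normal[of "Suc c"]]] by auto
  qed
  from twisted_generators[OF this S xy(1,2)] obtain m p where p: "poly_bounded p"
    and pT: "\<forall>\<phi>\<in>hom G G. \<forall>n. (\<forall>s\<in>S. word_le G S n (\<phi> s)) \<longrightarrow>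
      (\<exists>T. finite T \<and> card T \<le> m \<and> generate G T = twisted G \<phi> (lower_central G i) \<and>
        (\<forall>t\<in>T. word_le G S (p n) t))"
    unfolding xy(3) by (elim exE conjE)
  have "subgroup_norm G S (twisted_centralizer G i \<phi>) \<le> p (aut_norm G S \<phi>)"
    if \<phi>: "\<phi> \<in> hom G G" for \<phi>
  proof -
    obtain T where "finite T" "generate G T = twisted G \<phi> (lower_central G i)"
      "\<forall>t\<in>T. word_le G S (p (aut_norm G S \<phi>)) t"
      using pT \<phi> word_le_aut_norm[OF S \<phi>] by meson
    then show ?thesis
      by (intro subgroup_norm_le[of T]) (auto simp: twisted_centralizer_def twisted_def)
  qed
  then show ?thesis using p by blast
qed

end

theorem mainTheorem5:
  fixes N :: "('a, 'b) monoid_scheme" and S :: "'a set" and i :: nat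
  assumes "group N"
    and "nilpotent_group N"
    and "torsion_free N"
    and "finite S" and "S \<subseteq> carrier N" and "generate N S = carrier N"
    and "i > 0"
  shows "\<exists>(k::nat) (C::real). C > 0 \<and>
           (\<forall>\<phi> \<in> iso N N.
              real (subgroup_norm N S (twisted_centralizer N i \<phi>))
                \<le> C * (real (aut_norm N S \<phi>)) ^ k)"
proof -
  interpret group N by fact
  obtain c where c: "lower_central N c = {\<one>\<^bsub>N\<^esub>}"
    using assms(2) by (auto simp: nilpotent_group_def)
  obtain p where p: "poly_bounded p" "\<And>\<phi>. \<phi> \<in> hom N N \<Longrightarrow>
      subgroup_norm N S (twisted_centralizer N i \<phi>) \<le> p (aut_norm N S \<phi>)"
    using twisted_centralizer_norm_bound[OF assms(4-6) c assms(7)] by blast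
  obtain C k where Ck: "\<And>n. p n \<le> C * (n + 1) ^ k"
    using p(1) by (auto simp: poly_bounded_def)
  \<comment> \<open>For norm n at least 1, n + 1 is at most 2 n, whence the factor
    \<open>2 ^ k\<close>; the added 1 makes the constant positive even if C = 0.\<close>
  have "real (subgroup_norm N S (twisted_centralizer N i \<phi>))
      \<le> (real C * 2 ^ k + 1) * real (aut_norm N S \<phi>) ^ k" if \<phi>: "\<phi> \<in> iso N N" for \<phi>
  proof (cases "aut_norm N S \<phi> = 0")
    case True
    then have triv: "carrier N = {\<one>\<^bsub>N\<^esub>}"
      using trivial_if_aut_norm_zero[OF assms(4-6) \<phi>] by blast
    have "\<phi> \<one>\<^bsub>N\<^esub> = \<one>\<^bsub>N\<^esub>" using \<phi> hom_one[of \<phi> N N] assms(1) by (auto simp: iso_def)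
    then have "twisted_centralizer N i \<phi> = {\<one>\<^bsub>N\<^esub>}"
      using triv subgroup.one_closed[OF normal_imp_subgroup[OF lower_central_normal[OF assms(7)]]]
      by (auto simp: twisted_centralizer_def)
    \<comment> \<open>The empty set generates the trivial group, so the norm is 0.\<close>
    then have "subgroup_norm N S (twisted_centralizer N i \<phi>) \<le> 0"
      by (intro subgroup_norm_le[of "{}"]) (auto simp: generate_empty)
    then show ?thesis by simp
  next
    case False
    let ?n = "aut_norm N S \<phi>"
    have "subgroup_norm N S (twisted_centralizer N i \<phi>) \<le> C * (?n + 1) ^ k"
      using p(2) \<phi> Ck order_trans by (fastforce simp: iso_def)
    also have "\<dots> \<le> C * (2 * ?n) ^ k" using False by (intro mult_left_mono power_mono) auto
    finally have "real (subgroup_norm N S (twisted_centralizer N i \<phi>)) \<le> real (C * (2 * ?n) ^ k)"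
      by (rule of_nat_mono)
    also have "\<dots> \<le> (real C * 2 ^ k + 1) * real ?n ^ k"
      by (simp add: power_mult_distrib algebra_simps)
    finally show ?thesis .
  qed
  moreover have "real C * 2 ^ k + 1 > 0" by (intro add_nonneg_pos) auto
  ultimately show ?thesis by blast
qed

end
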